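(* Let $\Sigma$ be a finite alphabet, let $k\ge 1$, and let $P$ be an irreducible, invariant, $k$-step Markov probability measure on $\Sigma^{\mathbb{N}}$. Let $L=\{\sigma\in\Sigma^*: P(\sigma)>0\}$ and let $s\in\Sigma^{\mathbb{N}}$ be a sequence all of whose finite prefixes belong to $L$. Then $s$ is $P$-distributed if and only if no $P$-martingale on $L$ generated by a deterministic finite automaton succeeds on $s$.
   Context: Notation: for a word $\sigma\in\Sigma^*$, $[\sigma]$ is the set of sequences in $\Sigma^{\mathbb{N}}$ extending $\sigma$, $P(\sigma):=P([\sigma])$, and $P(\sigma\tau\mid\sigma):=P(\sigma\tau)/P(\sigma)$ when $P(\sigma)>0$. $T$ is the shift $(T(s))_n=s_{n+1}$. $s\upharpoonright_N$ is the word formed by the first $N$ symbols of $s$. $P$ is invariant if $P\circ T^{-1}=P$. $P$ is $k$-step Markov if for all words $\sigma,\tau$ with $|\sigma|\ge k$ (and $P(\sigma)>0$), $P(\sigma\tau\mid\sigma)=P(\rho\tau\mid\rho)$, where $\rho$ is the word of the last $k$ symbols of $\sigma$. $P$ is irreducible if for all words $\sigma,\tau$ with $P(\sigma)>0$ and $P(\tau)>0$ there is a word $\rho$ with $P(\sigma\rho\tau)>0$. A sequence $s$ is $P$-distributed if $\lim_{N\to\infty}\frac1N\sum_{n=0}^{N-1}f(T^ns)=\int f\,dP$ for all continuous real-valued $f$ (equivalently, for all indicator functions of cylinders $[\sigma]$). A $P$-martingale on $L$ is a function $f\colon L\to\mathbb{R}_{\ge 0}$ with $f(\sigma)=\sum_{a\in\Sigma,\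 \sigma a\in L}P(\sigma a\mid\sigma)f(\sigma a)$ for all $\sigma\in L$. It succeeds on $s$ if $\limsup_N f(s\upharpoonright_N)=\infty$. It is generated by a deterministic finite automaton (DFA) if there are a DFA with state set $Q$, input alphabet $\Sigma$, initial state $q_0$ and transition function $\delta$ (extended to words as $\delta^*$) which accepts exactly the language $L$, and a function $b\colon Q\times\Sigma\to\mathbb{R}$, such that $f(\sigma a)=b(\delta^*(\sigma,q_0),a)\,f(\sigma)$ for every word $\sigma$ and symbol $a$ with $\sigma a\in L$. *)

theory Defs
  imports "HOL-Probability.Probability"
begin

text \<open>The alphabet is a type \<open>'a :: finite\<close>; finite words are lists over it and infinite
  sequences are functions \<open>nat \<Rightarrow> 'a\<close>.\<close>

section \<open>Measures on sequences\<close>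

definition seq_space :: "(nat \<Rightarrow> 'a) measure" where
  "seq_space = (\<Pi>\<^sub>M i\<in>UNIV. count_space UNIV)"

definition seq_topology :: "(nat \<Rightarrow> 'a) topology" where
  "seq_topology = product_topology (\<lambda>i. discrete_topology UNIV) UNIV"

definition seq_prefix :: "nat \<Rightarrow> (nat \<Rightarrow> 'a) \<Rightarrow> 'a list" where
  "seq_prefix N s = map s [0..<N]"

definition cylinder :: "'a list \<Rightarrow> (nat \<Rightarrow> 'a) set" where
  "cylinder \<sigma> = {s. seq_prefix (length \<sigma>) s = \<sigma>}"

definition seq_shift :: "(nat \<Rightarrow> 'a) \<Rightarrow> (nat \<Rightarrow> 'a)" where
  "seq_shift s = (\<lambda>n. s (Suc n))"

definition seq_prob_measure :: "(nat \<Rightarrow> 'a) measure \<Rightarrow> bool" where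
  "seq_prob_measure P \<longleftrightarrow> prob_space P \<and> sets P = sets seq_space"

definition word_prob :: "(nat \<Rightarrow> 'a) measure \<Rightarrow> 'a list \<Rightarrow> real" where
  "word_prob P \<sigma> = measure P (cylinder \<sigma>)"

text \<open>\<open>word_cond_prob P \<tau> \<sigma>\<close> stands for \<open>P(\<sigma>\<tau> | \<sigma>)\<close>; it is meaningful only if \<open>P(\<sigma>) > 0\<close>.\<close>

definition word_cond_prob :: "(nat \<Rightarrow> 'a) measure \<Rightarrow> 'a list \<Rightarrow> 'a list \<Rightarrow> real" where
  "word_cond_prob P \<tau> \<sigma> = word_prob P (\<sigma> @ \<tau>) / word_prob P \<sigma>"

definition support_lang :: "(nat \<Rightarrow> 'a) measure \<Rightarrow> 'a list set" where
  "support_lang P = {\<sigma>. word_prob P \<sigma> > 0}"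

definition shift_invariant :: "(nat \<Rightarrow> 'a) measure \<Rightarrow> bool" where
  "shift_invariant P \<longleftrightarrow> distr P P seq_shift = P"

text \<open>\<open>drop (length \<sigma> - k) \<sigma>\<close> is the word of the last \<open>k\<close> symbols of \<open>\<sigma>\<close>. For invariant \<open>P\<close>
  it has positive probability whenever \<open>\<sigma>\<close> has, so both quotients are meaningful.\<close>

definition step_markov :: "nat \<Rightarrow> (nat \<Rightarrow> 'a) measure \<Rightarrow> bool" where
  "step_markov k P \<longleftrightarrow>
    (\<forall>\<sigma> \<tau>. k \<le> length \<sigma> \<longrightarrow> word_prob P \<sigma> > 0 \<longrightarrow>
      word_cond_prob P \<tau> \<sigma> = word_cond_prob P \<tau> (drop (length \<sigma> - k) \<sigma>))"

definition irreducible_measure :: "(nat \<Rightarrow> 'a) measure \<Rightarrow> bool" where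
  "irreducible_measure P \<longleftrightarrow>
    (\<forall>\<sigma> \<tau>. word_prob P \<sigma> > 0 \<longrightarrow> word_prob P \<tau> > 0 \<longrightarrow>
      (\<exists>\<rho>. word_prob P (\<sigma> @ \<rho> @ \<tau>) > 0))"

definition distributed_seq :: "(nat \<Rightarrow> 'a) measure \<Rightarrow> (nat \<Rightarrow> 'a) \<Rightarrow> bool" where
  "distributed_seq P s \<longleftrightarrow>
    (\<forall>f :: (nat \<Rightarrow> 'a) \<Rightarrow> real. continuous_map seq_topology euclideanreal f \<longrightarrow>
      (\<lambda>N. (1 / real N) * (\<Sum>n<N. f ((seq_shift ^^ n) s))) \<longlonglongrightarrow> (LINT x|P. f x))"

section \<open>Martingales\<close>

text \<open>A function on a language \<open>L\<close> is represented by a total function on words whose values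
  outside \<open>L\<close> are ignored.\<close>

definition word_martingale ::
    "('a::finite list \<Rightarrow> real) \<Rightarrow> (nat \<Rightarrow> 'a) measure \<Rightarrow> 'a list set \<Rightarrow> bool" where
  "word_martingale f P L \<longleftrightarrow>
    (\<forall>\<sigma>\<in>L. f \<sigma> \<ge> 0) \<and>
    (\<forall>\<sigma>\<in>L. f \<sigma> = (\<Sum>a | \<sigma> @ [a] \<in> L. word_cond_prob P [a] \<sigma> * f (\<sigma> @ [a])))"

definition succeeds_on :: "('a list \<Rightarrow> real) \<Rightarrow> (nat \<Rightarrow> 'a) \<Rightarrow> bool" where
  "succeeds_on f s \<longleftrightarrow> limsup (\<lambda>N. ereal (f (seq_prefix N s))) = \<infinity>"

section \<open>Deterministic finite automata\<close>

record ('q, 'a) dfa =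
  dfa_states :: "'q set"
  dfa_init :: 'q
  dfa_final :: "'q set"
  dfa_trans :: "'q \<Rightarrow> 'a \<Rightarrow> 'q"

definition is_dfa :: "('q, 'a) dfa \<Rightarrow> bool" where
  "is_dfa A \<longleftrightarrow> finite (dfa_states A) \<and> dfa_init A \<in> dfa_states A \<and>
    dfa_final A \<subseteq> dfa_states A \<and>
    (\<forall>q\<in>dfa_states A. \<forall>a. dfa_trans A q a \<in> dfa_states A)"

definition dfa_run :: "('q, 'a) dfa \<Rightarrow> 'a list \<Rightarrow> 'q" where
  "dfa_run A \<sigma> = foldl (dfa_trans A) (dfa_init A) \<sigma>"

definition dfa_lang :: "('q, 'a) dfa \<Rightarrow> 'a list set" where
  "dfa_lang A = {\<sigma>. dfa_run A \<sigma> \<in> dfa_final A}"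

definition dfa_generates ::
    "('q, 'a) dfa \<Rightarrow> ('q \<Rightarrow> 'a \<Rightarrow> real) \<Rightarrow> 'a list set \<Rightarrow> ('a list \<Rightarrow> real) \<Rightarrow> bool" where
  "dfa_generates A b L f \<longleftrightarrow> is_dfa A \<and> dfa_lang A = L \<and>
    (\<forall>\<sigma> a. \<sigma> @ [a] \<in> L \<longrightarrow> f (\<sigma> @ [a]) = b (dfa_run A \<sigma>) a * f \<sigma>)"

text \<open>HOL cannot quantify over the type of states inside a formula, so states are taken to be
  natural numbers. Since state sets are finite this is no restriction, as the lemma below shows.\<close>

definition dfa_generated :: "'a list set \<Rightarrow> ('a list \<Rightarrow> real) \<Rightarrow> bool" where
  "dfa_generated L f \<longleftrightarrow> (\<exists>(A :: (nat, 'a) dfa) b. dfa_generates A b L f)"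

lemma dfa_generated_any_state_type:
  fixes A :: "('q, 'a) dfa"
  assumes "dfa_generates A b L f"
  shows "dfa_generated L f"
proof -
  let ?Q = "dfa_states A"
  have A: "is_dfa A" "dfa_lang A = L"
    and f: "\<And>\<sigma> a. \<sigma> @ [a] \<in> L \<Longrightarrow> f (\<sigma> @ [a]) = b (dfa_run A \<sigma>) a * f \<sigma>"
    using assms unfolding dfa_generates_def by blast+
  obtain h :: "'q \<Rightarrow> nat" where h: "inj_on h ?Q"
    using A(1) finite_imp_inj_to_nat_seg[of ?Q] by (auto simp: is_dfa_def)
  define g where "g = inv_into ?Q h"
  have gh: "g (h q) = q" if "q \<in> ?Q" for q
    using h that by (simp add: g_def)
  define B where "B = \<lparr>dfa_states = h ` ?Q, dfa_init = h (dfa_init A),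
    dfa_final = h ` dfa_final A, dfa_trans = (\<lambda>q a. h (dfa_trans A (g q) a))\<rparr>"
  have runQ: "dfa_run A \<sigma> \<in> ?Q" for \<sigma>
    using A(1) by (induction \<sigma> rule: rev_induct) (auto simp: dfa_run_def is_dfa_def)
  have runB: "dfa_run B \<sigma> = h (dfa_run A \<sigma>)" for \<sigma>
  proof (induction \<sigma> rule: rev_induct)
    case (snoc a \<sigma>)
    then show ?case using gh[OF runQ[of \<sigma>]] by (simp add: dfa_run_def B_def)
  qed (simp add: dfa_run_def B_def)
  have "is_dfa B" using A(1) by (auto simp: is_dfa_def B_def gh)
  moreover have "dfa_lang B = L"
  proof -
    have "h (dfa_run A \<sigma>) \<in> h ` dfa_final A \<longleftrightarrow> dfa_run A \<sigma> \<in> dfa_final A" for \<sigma>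
      using A(1) h runQ[of \<sigma>] by (simp add: is_dfa_def inj_on_image_mem_iff)
    then show ?thesis using A(2) by (simp add: dfa_lang_def runB) (simp add: B_def)
  qed
  ultimately have "dfa_generates B (\<lambda>q. b (g q)) L f"
    using f by (simp add: dfa_generates_def runB gh runQ)
  then show ?thesis unfolding dfa_generated_def by blast
qed

end

theory Submission
  imports Defs
begin

text \<open>If \<open>s\<close> is \<open>P\<close>-distributed, consider the square root of an automatic martingale, killed as
  soon as no genuine bet can follow any more (from then on the capital is constant). There are
  finitely many states of play (automaton state and last \<open>k\<close> symbols), and in each of them
  strict concavity makes the conditional mean of this root decay; so over long enough blocks it shrinks by any prescribed factor. Along \<open>s\<close>, the
  logarithm of the capital gained on a block is bounded via \<open>ln x \<le> x - 1\<close> by a function of a window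
  of bounded length. Averaging over all overlapping windows gives a negative rate.

  Conversely, if no automatic martingale succeeds, betting a small amount \<open>e\<close> on or against symbol
  \<open>a\<close> after every occurrence of \<open>w\<close> shows that the conditional frequency of \<open>a\<close> after \<open>w\<close> is the
  right one. Every limit point of the frequencies of words of length \<open>k\<close> is then a stationary vector
  of an irreducible chain, and such a vector is unique.\<close>

section \<open>Words and cylinders\<close>

text \<open>The state of the automaton depends on the whole past of \<open>s\<close>, whereas being
  distributed controls only functions of bounded windows. A window function must therefore dominate
  the gain for whichever state of play is current: it sums over all of them, which costs a factor
  equal to their number. So mere decay of the root is not enough; blocks must be long enough to push
  it below the reciprocal of that number. Blocks at multiples of a fixed length would ask for
  frequencies along an arithmetic progression; using all starting positions avoids this, and the
  lagged differences of logarithms still telescope. Roots are averaged instead of logarithms because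
  the capital may vanish on some continuations. Killing is needed because the root of a martingale
  that has become constant does not decay; along \<open>s\<close> such a martingale is bounded
  anyway. In the converse, the gain is linear in the size of the bet and the loss quadratic, so a
  small fixed bet turns a recurring deviation into exponential growth at infinitely many times.
  Uniqueness of the stationary vector also covers periodic chains.\<close>

abbreviation words :: "nat \<Rightarrow> 'a list set" where
  "words n \<equiv> {\<sigma>. length \<sigma> = n}"

lemma finite_words [simp]: "finite (words n :: 'a::finite list set)"
  using finite_lists_length_eq[of "UNIV :: 'a set" n] by simp

lemma sum_words_append:
  fixes g :: "'a::finite list \<Rightarrow> 'b::comm_monoid_add"
  shows "(\<Sum>\<sigma>\<in>words (m + n). g \<sigma>) = (\<Sum>\<sigma>\<in>words m. \<Sum>\<tau>\<in>words n. g (\<sigma> @ \<tau>))"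
  unfolding sum.cartesian_product
  by (rule sum.reindex_bij_witness[where i = "\<lambda>(\<sigma>, \<tau>). \<sigma> @ \<tau>" and j = "\<lambda>\<sigma>. (take m \<sigma>, drop m \<sigma>)"]) auto

lemma sum_words_1:
  fixes g :: "'a::finite list \<Rightarrow> 'b::comm_monoid_add"
  shows "(\<Sum>\<sigma>\<in>words (Suc 0). g \<sigma>) = (\<Sum>a\<in>UNIV. g [a])"
  by (rule sum.reindex_bij_witness[where i = "\<lambda>a. [a]" and j = hd]) (auto simp: length_Suc_conv)

lemma sum_words_Suc_Cons:
  fixes g :: "'a::finite list \<Rightarrow> 'b::comm_monoid_add"
  shows "(\<Sum>\<sigma>\<in>words (Suc n). g \<sigma>) = (\<Sum>a\<in>UNIV. \<Sum>\<sigma>\<in>words n. g (a # \<sigma>))"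
  using sum_words_append[of g "Suc 0" n] sum_words_1[of "\<lambda>\<sigma>. \<Sum>\<tau>\<in>words n. g (\<sigma> @ \<tau>)"] by simp

lemma seq_shift_funpow: "(seq_shift ^^ n) s = (\<lambda>i. s (n + i))"
  by (induction n) (auto simp: seq_shift_def)

lemma seq_prefix_shift: "seq_prefix m ((seq_shift ^^ n) s) = map s [n..<n + m]"
  by (auto simp: seq_prefix_def seq_shift_funpow intro!: nth_equalityI)

lemma length_seq_prefix [simp]: "length (seq_prefix n s) = n"
  by (simp add: seq_prefix_def)

lemma seq_prefix_Suc: "seq_prefix (Suc n) s = seq_prefix n s @ [s n]"
  by (simp add: seq_prefix_def)

lemma seq_prefix_add: "seq_prefix (n + m) s = seq_prefix n s @ map s [n..<n + m]"
  unfolding seq_prefix_def map_append[symmetric] by (simp add: upt_add_eq_append[of 0, simplified])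

lemma seq_prefix_Suc_Cons: "seq_prefix (Suc n) s = s 0 # seq_prefix n (seq_shift s)"
  unfolding seq_prefix_def seq_shift_def by (rule map_upt_Suc)

lemma cylinder_Nil [simp]: "cylinder [] = UNIV"
  by (simp add: cylinder_def seq_prefix_def)

lemma cylinder_snoc: "cylinder \<sigma> = (\<Union>a. cylinder (\<sigma> @ [a]))"
  by (auto simp: cylinder_def seq_prefix_Suc)

section \<open>Shift, cylinders and continuous functions\<close>

lemma shift_vimage_cylinder: "seq_shift -` cylinder \<sigma> = (\<Union>a. cylinder (a # \<sigma>))"
  by (auto simp: cylinder_def seq_prefix_Suc_Cons)

text \<open>Every map out of a discrete space is continuous, so the prefix map into a discrete space
  is what matters. It is built up one coordinate at a time, the product of two discrete spaces being
  discrete.\<close>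

lemma continuous_map_prefix:
  fixes G :: "'a list \<Rightarrow> real"
  shows "continuous_map seq_topology euclideanreal (\<lambda>x. G (seq_prefix m x))"
proof -
  have comp: "continuous_map seq_topology (discrete_topology UNIV) (\<lambda>x. x i)" for i :: nat
    unfolding seq_topology_def by (rule continuous_map_product_projection) simp
  have "continuous_map seq_topology (discrete_topology UNIV) (seq_prefix m :: _ \<Rightarrow> 'a list)"
  proof (induction m)
    case 0
    have "seq_prefix 0 = (\<lambda>x::nat \<Rightarrow> 'a. [])"
      by (auto simp: seq_prefix_def)
    then show ?case by simp
  next
    case (Suc m)
    have "continuous_map seq_topology (prod_topology (discrete_topology UNIV) (discrete_topology UNIV))
        (\<lambda>x::nat \<Rightarrow> 'a. (seq_prefix m x, x m))"
      by (intro continuous_map_pairedI Suc comp)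
    then have "continuous_map seq_topology (discrete_topology UNIV)
        (\<lambda>x::nat \<Rightarrow> 'a. (seq_prefix m x, x m))"
      by (simp add: prod_topology_discrete_topology[symmetric])
    from continuous_map_compose[OF this, of "discrete_topology UNIV" "\<lambda>(\<sigma>, a). \<sigma> @ [a]"]
    show ?case by (simp add: comp_def seq_prefix_Suc)
  qed
  from continuous_map_compose[OF this, of euclideanreal G]
  show ?thesis by (simp add: comp_def)
qed

text \<open>Compactness of the sequence space, from finiteness of the alphabet by Tychonoff:
  finitely many cylinders on which \<open>f\<close> varies little cover everything, and
  \<open>m\<close> is the greatest of their lengths.\<close>

lemma continuous_map_seq_uniform:
  fixes f :: "(nat \<Rightarrow> 'a::finite) \<Rightarrow> real"
  assumes f: "continuous_map seq_topology euclideanreal f" and e: "e > 0"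
  obtains m where "\<And>x y. seq_prefix m x = seq_prefix m y \<Longrightarrow> \<bar>f x - f y\<bar> < e"
proof -
  have prefix_eq: "seq_prefix m x = seq_prefix m y \<longleftrightarrow> (\<forall>i<m. x i = y i)" for m and x y :: "nat \<Rightarrow> 'a"
    by (auto simp: seq_prefix_def)
  have openC: "openin seq_topology {y. seq_prefix m y = seq_prefix m x}" for m and x :: "nat \<Rightarrow> 'a"
  proof -
    have "continuous_map seq_topology euclideanreal (\<lambda>y. of_bool (seq_prefix m y = seq_prefix m x) :: real)"
      by (rule continuous_map_prefix)
    from openin_continuous_map_preimage[OF this, of "{1/2<..}"]
    moreover have "{y \<in> topspace seq_topology. of_bool (seq_prefix m y = seq_prefix m x) \<in> {1 / 2 :: real<..}}
        = {y. seq_prefix m y = seq_prefix m x}"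
      by (auto simp: seq_topology_def)
    ultimately show ?thesis by simp
  qed
  \<comment> \<open>A basic open set restricts finitely many coordinates, so every neighbourhood of
    \<open>x\<close> contains a cylinder around \<open>x\<close>. The radius \<open>e / 2\<close>
    lets two points be compared through the centre.\<close>
  have "\<exists>m. \<forall>y. seq_prefix m y = seq_prefix m x \<longrightarrow> \<bar>f y - f x\<bar> < e / 2" for x
  proof -
    have "openin seq_topology {y \<in> topspace seq_topology. f y \<in> ball (f x) (e / 2)}"
      by (rule openin_continuous_map_preimage[OF f]) simp
    then have "openin (product_topology (\<lambda>i. discrete_topology UNIV) UNIV) {y. f y \<in> ball (f x) (e / 2)}"
      by (simp add: seq_topology_def)
    moreover have "x \<in> {y. f y \<in> ball (f x) (e / 2)}" using e by simp
    ultimately have "\<exists>U. finite {i \<in> UNIV. U i \<noteq> topspace (discrete_topology (UNIV :: 'a set))} \<and>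
        (\<forall>i\<in>UNIV. openin (discrete_topology UNIV) (U i)) \<and>
        x \<in> PiE UNIV U \<and> PiE UNIV U \<subseteq> {y. f y \<in> ball (f x) (e / 2)}"
      by (rule bspec[OF iffD1[OF openin_product_topology_alt]])
    then obtain U where fin: "finite {i \<in> UNIV. U i \<noteq> topspace (discrete_topology (UNIV :: 'a set))}"
      and U: "x \<in> PiE UNIV U" "PiE UNIV U \<subseteq> {y. f y \<in> ball (f x) (e / 2)}"
      by (elim exE conjE) rule
    from fin have "finite {i. U i \<noteq> (UNIV :: 'a set)}" by simp
    then obtain m where m: "\<And>i. U i \<noteq> UNIV \<Longrightarrow> i < m"
      by (metis (mono_tags) finite_nat_set_iff_bounded mem_Collect_eq)
    have "y \<in> PiE UNIV U" if "seq_prefix m y = seq_prefix m x" for y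
      using that U(1) m unfolding prefix_eq PiE_UNIV_domain Pi_iff by (metis UNIV_I)
    with U(2) have "\<bar>f y - f x\<bar> < e / 2" if "seq_prefix m y = seq_prefix m x" for y
      using that by (auto simp: dist_real_def abs_minus_commute dest!: subsetD)
    then show ?thesis by blast
  qed
  then obtain h where h: "\<And>x y. seq_prefix (h x) y = seq_prefix (h x) x \<Longrightarrow> \<bar>f y - f x\<bar> < e / 2"
    by metis
  have "compact_space (seq_topology :: (nat \<Rightarrow> 'a) topology)"
    unfolding seq_topology_def by (simp add: compact_space_product_topology compact_space_discrete_topology)
  then have comp: "compactin seq_topology (topspace seq_topology :: (nat \<Rightarrow> 'a) set)"
    by (simp add: compact_space_def)
  define C where "C x = {y. seq_prefix (h x) y = seq_prefix (h x) x}" for x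
  have "\<exists>D. finite D \<and> D \<subseteq> range C \<and> topspace seq_topology \<subseteq> \<Union>D"
    by (rule compactinD[OF comp]) (auto simp: C_def openC)
  then obtain D where D: "finite D" "D \<subseteq> range C" "topspace seq_topology \<subseteq> \<Union>D"
    by (elim exE conjE) rule
  obtain X where X: "finite X" "D = C ` X"
    using finite_subset_image[OF D(1,2)] by (elim exE conjE) rule
  show thesis
  proof
    fix x y :: "nat \<Rightarrow> 'a" assume xy: "seq_prefix (Max (insert 0 (h ` X))) x = seq_prefix (Max (insert 0 (h ` X))) y"
    have "x \<in> \<Union>D" using D(3) by (auto simp: seq_topology_def)
    then obtain z where z: "z \<in> X" "seq_prefix (h z) x = seq_prefix (h z) z"
      unfolding X(2) C_def by blast
    have "h z \<le> Max (insert 0 (h ` X))" using X(1) z(1) by simp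
    then have "seq_prefix (h z) y = seq_prefix (h z) x"
      using xy unfolding prefix_eq by (metis less_le_trans)
    then have "\<bar>f x - f z\<bar> < e / 2" "\<bar>f y - f z\<bar> < e / 2" using h z(2) by metis+
    then show "\<bar>f x - f y\<bar> < e" by linarith
  qed
qed

section \<open>Probabilities of words\<close>

lemma seq_measure_space:
  assumes "seq_prob_measure P"
  shows "space P = UNIV"
  using assms sets_eq_imp_space_eq[of P seq_space]
  by (simp add: seq_prob_measure_def seq_space_def space_PiM)

lemma measurable_seq_prefix:
  assumes "seq_prob_measure (P :: (nat \<Rightarrow> 'a::finite) measure)"
  shows "seq_prefix n \<in> measurable P (count_space UNIV)"
proof -
  have "seq_prefix n \<in> measurable (seq_space :: (nat \<Rightarrow> 'a) measure) (count_space UNIV)"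
  proof (induction n)
    case 0
    have "seq_prefix 0 = (\<lambda>x::nat \<Rightarrow> 'a. [])" by (auto simp: seq_prefix_def)
    then show ?case by simp
  next
    case (Suc n)
    have [measurable]: "(\<lambda>x. x n) \<in> measurable (seq_space :: (nat \<Rightarrow> 'a) measure) (count_space UNIV)"
      unfolding seq_space_def by (rule measurable_component_singleton) simp
    note Suc [measurable]
    show ?case unfolding seq_prefix_Suc by measurable
  qed
  moreover have "sets P = sets seq_space"
    using assms by (simp add: seq_prob_measure_def)
  ultimately show ?thesis
    using measurable_cong_sets[of P seq_space "count_space UNIV" "count_space UNIV"] by simp
qed

lemma cylinder_in_sets:
  assumes "seq_prob_measure (P :: (nat \<Rightarrow> 'a::finite) measure)"
  shows "cylinder \<sigma> \<in> sets P"
  using measurable_sets[OF measurable_seq_prefix[OF assms, of "length \<sigma>"], of "{\<sigma>}"]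
  by (simp add: cylinder_def vimage_def seq_measure_space[OF assms])

lemma integral_prefix:
  fixes G :: "'a::finite list \<Rightarrow> real"
  assumes P: "seq_prob_measure P"
  shows "(LINT x|P. G (seq_prefix n x)) = (\<Sum>\<sigma>\<in>words n. word_prob P \<sigma> * G \<sigma>)"
    and "integrable P (\<lambda>x. G (seq_prefix n x))"
proof -
  interpret prob_space P using P by (simp add: seq_prob_measure_def)
  note cyl = cylinder_in_sets[OF P]
  have eq: "G (seq_prefix n x) = (\<Sum>\<sigma>\<in>words n. G \<sigma> * indicator (cylinder \<sigma>) x)" for x
  proof -
    have "(\<Sum>\<sigma>\<in>words n. G \<sigma> * indicator (cylinder \<sigma>) x)
        = (\<Sum>\<sigma>\<in>words n. if \<sigma> = seq_prefix n x then G \<sigma> else 0)"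
      by (rule sum.cong) (auto simp: cylinder_def indicator_def)
    then show ?thesis by simp
  qed
  have int: "integrable P (\<lambda>x. G \<sigma> * indicator (cylinder \<sigma>) x)" for \<sigma>
    using cyl[of \<sigma>] by (auto intro!: integrable_mult_right integrable_real_indicator simp: emeasure_eq_measure)
  show "integrable P (\<lambda>x. G (seq_prefix n x))"
    unfolding eq by (intro Bochner_Integration.integrable_sum int)
  show "(LINT x|P. G (seq_prefix n x)) = (\<Sum>\<sigma>\<in>words n. word_prob P \<sigma> * G \<sigma>)"
    unfolding eq using int cyl by (subst Bochner_Integration.integral_sum) (auto simp: word_prob_def seq_measure_space[OF P] mult.commute)
qed

locale invariant_seq_measure =
  fixes P :: "(nat \<Rightarrow> 'a::finite) measure"
  assumes prob_measure: "seq_prob_measure P" and invariant: "shift_invariant P"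
begin

sublocale prob_space P
  using prob_measure by (simp add: seq_prob_measure_def)

abbreviation p :: "'a list \<Rightarrow> real" where "p \<equiv> word_prob P"
abbreviation L :: "'a list set" where "L \<equiv> support_lang P"

lemma space_P [simp]: "space P = UNIV"
  by (rule seq_measure_space[OF prob_measure])

lemma cylinder_sets [measurable]: "cylinder \<sigma> \<in> sets P"
  by (rule cylinder_in_sets[OF prob_measure])

lemma p_nonneg [simp]: "0 \<le> p \<sigma>"
  by (simp add: word_prob_def)

lemma in_L: "\<sigma> \<in> L \<longleftrightarrow> 0 < p \<sigma>"
  by (simp add: support_lang_def)

lemma notin_L: "\<sigma> \<notin> L \<longleftrightarrow> p \<sigma> = 0"
  using p_nonneg[of \<sigma>] by (auto simp: in_L simp del: p_nonneg)

lemma p_Nil [simp]: "p [] = 1"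
  using prob_space by (simp add: word_prob_def)

lemma measure_UN_cylinder:
  assumes "\<And>a b. a \<noteq> b \<Longrightarrow> \<phi> a \<noteq> \<phi> b" "\<And>a. length (\<phi> a) = n"
  shows "prob (\<Union>a. cylinder (\<phi> a)) = (\<Sum>a::'a\<in>UNIV. p (\<phi> a))"
proof -
  have "disjoint_family (\<lambda>a. cylinder (\<phi> a))"
    using assms by (auto simp: disjoint_family_on_def cylinder_def)
  then show ?thesis
    unfolding word_prob_def by (intro finite_measure_finite_Union) auto
qed

lemma p_snoc: "p \<sigma> = (\<Sum>a\<in>UNIV. p (\<sigma> @ [a]))"
  using measure_UN_cylinder[of "\<lambda>a. \<sigma> @ [a]" "Suc (length \<sigma>)"] cylinder_snoc[of \<sigma>]
  by (simp add: word_prob_def)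

text \<open>Invariance enters only in this form: the preimage of a cylinder under the shift splits
  according to the first symbol.\<close>

lemma p_Cons: "p \<sigma> = (\<Sum>a\<in>UNIV. p (a # \<sigma>))"
proof -
  have m: "seq_shift \<in> measurable P P"
  proof -
    have "seq_shift \<in> measurable seq_space (seq_space :: (nat \<Rightarrow> 'a) measure)"
      unfolding seq_space_def seq_shift_def
      by (rule measurable_PiM_single') (auto intro!: measurable_component_singleton)
    moreover have "sets P = sets seq_space"
      using prob_measure by (simp add: seq_prob_measure_def)
    ultimately show ?thesis using measurable_cong_sets[of P seq_space P seq_space] by simp
  qed
  have "p \<sigma> = measure (distr P P seq_shift) (cylinder \<sigma>)"
    using invariant by (simp add: word_prob_def shift_invariant_def)
  also have "\<dots> = prob (\<Union>a. cylinder (a # \<sigma>))"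
    by (subst measure_distr[OF m]) (auto simp: shift_vimage_cylinder)
  also have "\<dots> = (\<Sum>a\<in>UNIV. p (a # \<sigma>))"
    by (rule measure_UN_cylinder[of _ "Suc (length \<sigma>)"]) auto
  finally show ?thesis .
qed

lemma p_append: "p \<sigma> = (\<Sum>\<tau>\<in>words n. p (\<sigma> @ \<tau>))"
proof (induction n arbitrary: \<sigma>)
  case 0
  have "words 0 = {[] :: 'a list}" by auto
  then show ?case by simp
next
  case (Suc n)
  have "(\<Sum>\<tau>\<in>words (Suc n). p (\<sigma> @ \<tau>)) = (\<Sum>a\<in>UNIV. \<Sum>\<tau>\<in>words n. p ((\<sigma> @ [a]) @ \<tau>))"
    by (simp add: sum_words_Suc_Cons)
  also have "\<dots> = (\<Sum>a\<in>UNIV. p (\<sigma> @ [a]))"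
    by (rule sum.cong[OF refl], rule Suc[symmetric])
  also have "\<dots> = p \<sigma>" by (rule p_snoc[symmetric])
  finally show ?case by simp
qed

lemma p_append_le: "p (\<sigma> @ \<tau>) \<le> p \<sigma>"
  unfolding p_append[of \<sigma> "length \<tau>"] by (rule member_le_sum) auto

lemma p_append_le2: "p (\<sigma> @ \<tau>) \<le> p \<tau>"
proof (induction \<sigma>)
  case (Cons a \<sigma>)
  have "p (a # \<sigma> @ \<tau>) \<le> p (\<sigma> @ \<tau>)"
    unfolding p_Cons[of "\<sigma> @ \<tau>"] by (rule member_le_sum) auto
  with Cons show ?case by simp
qed simp

lemma L_prefix: "\<sigma> @ \<tau> \<in> L \<Longrightarrow> \<sigma> \<in> L" and L_suffix: "\<sigma> @ \<tau> \<in> L \<Longrightarrow> \<tau> \<in> L"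
  using p_append_le[of \<sigma> \<tau>] p_append_le2[of \<sigma> \<tau>] by (auto simp: in_L)

end

section \<open>Frequencies of words\<close>

text \<open>Windows start before \<open>N\<close> but may reach beyond it. All lengths thus share
  the same \<open>N\<close> starting positions, and extending a word to the right gives an exact
  identity; extending to the left costs a boundary term.\<close>

definition word_freq :: "(nat \<Rightarrow> 'a) \<Rightarrow> 'a list \<Rightarrow> nat \<Rightarrow> real" where
  "word_freq s \<sigma> N = (1 / real N) * (\<Sum>n<N. of_bool (map s [n..<n + length \<sigma>] = \<sigma>))"

lemma word_freq_nonneg: "0 \<le> word_freq s \<sigma> N"
  by (auto simp: word_freq_def intro!: sum_nonneg)

lemma word_freq_le_1: "word_freq s \<sigma> N \<le> 1"
proof -
  have "(\<Sum>n<N. of_bool (map s [n..<n + length \<sigma>] = \<sigma>)) \<le> (\<Sum>n<N. 1 :: real)"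
    by (rule sum_mono) auto
  then show ?thesis by (auto simp: word_freq_def divide_simps)
qed

lemma prefix_average_word_freq:
  fixes G :: "'a::finite list \<Rightarrow> real"
  shows "(1 / real N) * (\<Sum>n<N. G (map s [n..<n + m])) = (\<Sum>\<sigma>\<in>words m. word_freq s \<sigma> N * G \<sigma>)"
proof -
  have G: "G (map s [n..<n + m]) = (\<Sum>\<sigma>\<in>words m. of_bool (map s [n..<n + length \<sigma>] = \<sigma>) * G \<sigma>)" for n
  proof -
    have "(\<Sum>\<sigma>\<in>words m. of_bool (map s [n..<n + length \<sigma>] = \<sigma>) * G \<sigma>)
        = (\<Sum>\<sigma>\<in>words m. if \<sigma> = map s [n..<n + m] then G \<sigma> else 0)"
      by (rule sum.cong) auto
    then show ?thesis by simp
  qed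
  show ?thesis
    unfolding G word_freq_def
    by (subst sum.swap) (simp add: sum_distrib_left sum_distrib_right mult.assoc)
qed

lemma word_freq_snoc: "word_freq s \<sigma> N = (\<Sum>a\<in>(UNIV :: 'a::finite set). word_freq s (\<sigma> @ [a]) N)"
proof -
  have "(of_bool (map s [n..<n + length \<sigma>] = \<sigma>) :: real)
      = (\<Sum>a\<in>UNIV. of_bool (map s [n..<n + length (\<sigma> @ [a])] = \<sigma> @ [a]))" for n
  proof -
    have "(\<Sum>a\<in>UNIV. of_bool (map s [n..<n + length (\<sigma> @ [a])] = \<sigma> @ [a]))
        = (\<Sum>a\<in>UNIV. if a = s (n + length \<sigma>) then of_bool (map s [n..<n + length \<sigma>] = \<sigma>) else 0 :: real)"
      by (rule sum.cong) auto
    then show ?thesis by simp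
  qed
  then show ?thesis
    unfolding word_freq_def sum_distrib_left[symmetric] by (subst sum.swap) simp
qed

lemma word_freq_append:
  fixes s :: "nat \<Rightarrow> 'a::finite"
  shows "word_freq s \<sigma> N = (\<Sum>\<tau>\<in>words n. word_freq s (\<sigma> @ \<tau>) N)"
proof (induction n arbitrary: \<sigma>)
  case 0
  have "words 0 = {[] :: 'a list}" by auto
  then show ?case by simp
next
  case (Suc n)
  have "(\<Sum>\<tau>\<in>words (Suc n). word_freq s (\<sigma> @ \<tau>) N)
      = (\<Sum>a\<in>UNIV. \<Sum>\<tau>\<in>words n. word_freq s ((\<sigma> @ [a]) @ \<tau>) N)"
    by (simp add: sum_words_Suc_Cons)
  also have "\<dots> = (\<Sum>a\<in>UNIV. word_freq s (\<sigma> @ [a]) N)"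
    by (rule sum.cong[OF refl], rule Suc[symmetric])
  also have "\<dots> = word_freq s \<sigma> N" by (rule word_freq_snoc[symmetric])
  finally show ?case by simp
qed

text \<open>Summing over the symbol in front counts occurrences of \<open>\<sigma>\<close> from
  position 1 instead of 0. The two counts differ by one boundary term at either end.\<close>

lemma word_freq_Cons_tendsto:
  fixes s :: "nat \<Rightarrow> 'a::finite"
  shows "(\<lambda>N. word_freq s \<sigma> N - (\<Sum>a\<in>UNIV. word_freq s (a # \<sigma>) N)) \<longlonglongrightarrow> 0"
proof (rule Lim_null_comparison[OF _ lim_1_over_n])
  let ?I = "\<lambda>n. of_bool (map s [n..<n + length \<sigma>] = \<sigma>) :: real"
  have "(\<Sum>a\<in>UNIV. of_bool (map s [n..<n + length (a # \<sigma>)] = a # \<sigma>)) = ?I (Suc n)" for n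
  proof -
    have "map s [n..<n + length (a # \<sigma>)] = s n # map s [Suc n..<Suc n + length \<sigma>]" for a
      by (subst upt_conv_Cons) (simp_all del: upt_Suc)
    then have "(\<Sum>a\<in>UNIV. of_bool (map s [n..<n + length (a # \<sigma>)] = a # \<sigma>))
        = (\<Sum>a\<in>UNIV. if a = s n then ?I (Suc n) else 0)"
      by (intro sum.cong) auto
    then show ?thesis by simp
  qed
  then have "(\<Sum>a\<in>UNIV. word_freq s (a # \<sigma>) N) = 1 / real N * (\<Sum>n<N. ?I (Suc n))" for N
    unfolding word_freq_def sum_distrib_left[symmetric] by (subst sum.swap) simp
  then have "word_freq s \<sigma> N - (\<Sum>a\<in>UNIV. word_freq s (a # \<sigma>) N) = 1 / real N * (?I 0 - ?I N)" for N
    using sum_lessThan_telescope'[of ?I N]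
    by (simp add: word_freq_def sum_subtractf flip: right_diff_distrib diff_divide_distrib)
  then show "\<forall>\<^sub>F N in sequentially. norm (word_freq s \<sigma> N - (\<Sum>a\<in>UNIV. word_freq s (a # \<sigma>) N)) \<le> 1 / real N"
    by (intro always_eventually allI) (auto simp: of_bool_def)
qed

context invariant_seq_measure
begin

text \<open>\<open>L\<close> is closed under prefixes and suffixes, so every window of
  \<open>s\<close> lies in it.\<close>

lemma word_freq_notin_L:
  assumes "\<And>N. seq_prefix N s \<in> L" "\<sigma> \<notin> L"
  shows "word_freq s \<sigma> N = 0"
proof -
  have "map s [n..<n + length \<sigma>] \<in> L" for n
    using assms(1)[of "n + length \<sigma>"] L_suffix unfolding seq_prefix_add by blast
  then have "map s [n..<n + length \<sigma>] \<noteq> \<sigma>" for n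
    using assms(2) by metis
  then show ?thesis by (simp add: word_freq_def)
qed

lemma distributed_average:
  fixes G :: "'a list \<Rightarrow> real"
  assumes "distributed_seq P s"
  shows "(\<lambda>N. (1 / real N) * (\<Sum>n<N. G (map s [n..<n + m]))) \<longlonglongrightarrow> (\<Sum>\<sigma>\<in>words m. p \<sigma> * G \<sigma>)"
  using assms continuous_map_prefix[of G m]
  unfolding distributed_seq_def by (fastforce simp: seq_prefix_shift integral_prefix[OF prob_measure])

text \<open>Continuous functions are uniform limits of functions of a finite prefix, whose averages
  and integrals are finite sums over words.\<close>

lemma distributedI:
  assumes freq: "\<And>\<sigma>. word_freq s \<sigma> \<longlonglongrightarrow> p \<sigma>"
  shows "distributed_seq P s"
  unfolding distributed_seq_def
proof (intro allI impI)
  fix f :: "(nat \<Rightarrow> 'a) \<Rightarrow> real"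
  assume f: "continuous_map seq_topology euclideanreal f"
  \<comment> \<open>\<open>ext\<close> picks one point of each cylinder, with an arbitrary tail, and
    \<open>G\<close> samples \<open>f\<close> there.\<close>
  define ext where "ext \<sigma> = (\<lambda>i. if i < length \<sigma> then \<sigma> ! i else undefined)" for \<sigma> :: "'a list"
  define G where "G \<sigma> = f (ext \<sigma>)" for \<sigma>
  have prefix_ext: "seq_prefix m x = seq_prefix m (ext (seq_prefix m x))" for m x
    by (auto simp: seq_prefix_def ext_def)
  have approx: "\<exists>m. \<forall>x. \<bar>f x - G (seq_prefix m x)\<bar> < e" if "e > 0" for e
  proof -
    obtain m where "\<And>x y. seq_prefix m x = seq_prefix m y \<Longrightarrow> \<bar>f x - f y\<bar> < e"
      using continuous_map_seq_uniform[OF f \<open>e > 0\<close>] by blast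
    then show ?thesis using prefix_ext unfolding G_def by blast
  qed
  have meas: "(\<lambda>x. G (seq_prefix m x)) \<in> borel_measurable P" for m
    using integral_prefix(2)[OF prob_measure, of G m] by simp
  \<comment> \<open>Uniform approximation by measurable functions of prefixes links the topology
    with the product sigma-algebra.\<close>
  have "f \<in> borel_measurable P"
  proof -
    obtain h where h: "\<And>j x. \<bar>f x - G (seq_prefix (h j) x)\<bar> < inverse (real (Suc j))"
      using approx[of "inverse (real (Suc _))"] by (metis inverse_positive_iff_positive of_nat_0_less_iff zero_less_Suc)
    show ?thesis
    proof (rule borel_measurable_LIMSEQ_metric[OF meas])
      fix x
      have "(\<lambda>j. G (seq_prefix (h j) x) - f x) \<longlonglongrightarrow> 0"
        by (rule Lim_null_comparison[OF _ LIMSEQ_inverse_real_of_nat])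
           (use h in \<open>auto simp: abs_minus_commute less_imp_le intro!: always_eventually\<close>)
      then show "(\<lambda>j. G (seq_prefix (h j) x)) \<longlonglongrightarrow> f x" by (simp add: LIM_zero_iff)
    qed
  qed
  moreover obtain B where "\<And>x. \<bar>f x\<bar> \<le> B"
  proof -
    obtain m where m: "\<And>x. \<bar>f x - G (seq_prefix m x)\<bar> < 1" using approx[of 1] by auto
    have "\<bar>f x\<bar> \<le> 1 + (\<Sum>\<sigma>\<in>words m. \<bar>G \<sigma>\<bar>)" for x
    proof -
      have "\<bar>G (seq_prefix m x)\<bar> \<le> (\<Sum>\<sigma>\<in>words m. \<bar>G \<sigma>\<bar>)"
        by (rule member_le_sum) auto
      then show ?thesis using m[of x] by linarith
    qed
    then show thesis by (rule that)
  qed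
  ultimately have int: "integrable P f"
    by (intro integrable_const_bound[of _ B]) auto
  show "(\<lambda>N. (1 / real N) * (\<Sum>n<N. f ((seq_shift ^^ n) s))) \<longlonglongrightarrow> (LINT x|P. f x)"
  proof (rule LIMSEQ_I)
    fix r :: real assume "0 < r"
    then obtain m where m: "\<And>x. \<bar>f x - G (seq_prefix m x)\<bar> < r / 3" using approx[of "r / 3"] by auto
    \<comment> \<open>Three errors of size \<open>r / 3\<close>: approximation along the orbit,
      convergence for \<open>G\<close>, approximation under the integral.\<close>
    let ?A = "\<lambda>N. (1 / real N) * (\<Sum>n<N. f ((seq_shift ^^ n) s))"
    let ?B = "\<lambda>N. (1 / real N) * (\<Sum>n<N. G (map s [n..<n + m]))"
    let ?I = "LINT x|P. G (seq_prefix m x)"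
    have "?B \<longlonglongrightarrow> ?I"
      unfolding prefix_average_word_freq integral_prefix(1)[OF prob_measure]
      by (intro tendsto_intros freq)
    then obtain N0 where N0: "\<And>N. N \<ge> N0 \<Longrightarrow> \<bar>?B N - ?I\<bar> < r / 3"
      using LIMSEQ_D[of ?B ?I "r / 3"] \<open>0 < r\<close> by auto
    have AB: "\<bar>?A N - ?B N\<bar> \<le> r / 3" for N
    proof -
      have "\<bar>(\<Sum>n<N. f ((seq_shift ^^ n) s)) - (\<Sum>n<N. G (map s [n..<n + m]))\<bar>
          \<le> (\<Sum>n<N. \<bar>f ((seq_shift ^^ n) s) - G (map s [n..<n + m])\<bar>)"
        unfolding sum_subtractf[symmetric] by (rule sum_abs)
      also have "\<dots> \<le> (\<Sum>n<N. r / 3)"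
        by (rule sum_mono) (use m in \<open>auto simp flip: seq_prefix_shift simp: less_imp_le\<close>)
      finally have "(1 / real N) * \<bar>(\<Sum>n<N. f ((seq_shift ^^ n) s)) - (\<Sum>n<N. G (map s [n..<n + m]))\<bar>
          \<le> (1 / real N) * (real N * (r / 3))"
        by (intro mult_left_mono) auto
      also have "\<dots> \<le> r / 3" using \<open>0 < r\<close> by simp
      finally show ?thesis
        unfolding right_diff_distrib[symmetric] abs_mult by simp
    qed
    have "\<bar>?I - (LINT x|P. f x)\<bar> \<le> r / 3"
    proof -
      have "\<bar>LINT x|P. G (seq_prefix m x) - f x\<bar> \<le> (LINT x|P. r / 3)"
        by (rule order_trans[OF integral_abs_bound integral_mono])
           (use m int integral_prefix(2)[OF prob_measure, of G m] in \<open>auto simp: abs_minus_commute less_imp_le\<close>)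
      then show ?thesis
        using int integral_prefix(2)[OF prob_measure, of G m] prob_space by simp
    qed
    then have "norm (?A N - (LINT x|P. f x)) < r" if "N \<ge> N0" for N
      using AB[of N] N0[OF that] unfolding real_norm_def by linarith
    then show "\<exists>N0. \<forall>N\<ge>N0. norm (?A N - (LINT x|P. f x)) < r" by blast
  qed
qed

end

section \<open>Martingales generated by finite automata along distributed sequences\<close>

text \<open>Truncated subtraction returns the whole word if it is shorter than \<open>n\<close>; the
  automaton \<open>suffix_dfa\<close> relies on this while it reads its first symbols.\<close>

definition last_symbols :: "nat \<Rightarrow> 'a list \<Rightarrow> 'a list" where
  "last_symbols n \<sigma> = drop (length \<sigma> - n) \<sigma>"

lemma last_symbols_append: "take (length \<sigma> - n) \<sigma> @ last_symbols n \<sigma> = \<sigma>"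
  by (simp add: last_symbols_def)

lemma length_last_symbols [simp]: "length (last_symbols n \<sigma>) = min n (length \<sigma>)"
  by (auto simp: last_symbols_def)

lemma last_symbols_neq: "length \<sigma> < length w \<Longrightarrow> last_symbols n \<sigma> \<noteq> w"
  by (auto simp: last_symbols_def)

lemma last_symbols_last_symbols: "m \<le> n \<Longrightarrow> last_symbols m (last_symbols n \<sigma>) = last_symbols m \<sigma>"
  by (auto simp: last_symbols_def intro!: arg_cong2[of _ _ _ _ drop])

lemma last_symbols_snoc: "last_symbols n (last_symbols n \<sigma> @ [a]) = last_symbols n (\<sigma> @ [a])"
  by (cases "n \<le> length \<sigma>") (auto simp: last_symbols_def Suc_diff_le)

lemma last_symbols_prefix:
  "k \<le> n \<Longrightarrow> last_symbols k (seq_prefix n s) = map s [n - k..<n]"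
  by (simp add: last_symbols_def seq_prefix_def drop_map)

lemma dfa_run_append: "dfa_run A (\<sigma> @ \<tau>) = foldl (dfa_trans A) (dfa_run A \<sigma>) \<tau>"
  by (simp add: dfa_run_def)

text \<open>Telescoping with lag \<open>m\<close>: summing gains over all overlapping blocks of
  length \<open>m\<close> leaves \<open>m\<close> terms at either end.\<close>

lemma sum_lag:
  fixes g :: "nat \<Rightarrow> real"
  shows "(\<Sum>i<N. g (i + m) - g i) = (\<Sum>i<m. g (N + i)) - (\<Sum>i<m. g i)"
proof (induction N)
  case (Suc N)
  have "(\<Sum>i<m. g (Suc N + i)) + g N = (\<Sum>i<Suc m. g (N + i))"
    by (subst sum.lessThan_Suc_shift) simp
  also have "\<dots> = (\<Sum>i<m. g (N + i)) + g (N + m)" by simp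
  finally show ?case using Suc by simp
qed simp

locale markov_seq_measure = invariant_seq_measure P for P :: "(nat \<Rightarrow> 'a::finite) measure" +
  fixes k :: nat
  assumes markov: "step_markov k P"
begin

lemma p_last_symbols_pos: "\<sigma> \<in> L \<Longrightarrow> p (last_symbols n \<sigma>) > 0"
  using L_suffix[of "take (length \<sigma> - n) \<sigma>" "last_symbols n \<sigma>"] by (simp add: last_symbols_append in_L)

lemma cond_last_symbols:
  assumes "\<sigma> \<in> L" "k \<le> length \<sigma>"
  shows "p (\<sigma> @ \<tau>) / p \<sigma> = p (last_symbols k \<sigma> @ \<tau>) / p (last_symbols k \<sigma>)"
  using markov assms by (simp add: step_markov_def in_L word_cond_prob_def last_symbols_def)

text \<open>The two words may have different lengths; equal last \<open>k\<close> symbols give both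
  the same conditional future.\<close>

lemma cond_cong:
  assumes "\<sigma> \<in> L" "k \<le> length \<sigma>" "\<sigma>' \<in> L" "k \<le> length \<sigma>'"
    and "last_symbols k \<sigma> = last_symbols k \<sigma>'"
  shows "p (\<sigma> @ \<tau>) / p \<sigma> = p (\<sigma>' @ \<tau>) / p \<sigma>'"
  using assms by (simp add: cond_last_symbols)

end

locale dfa_martingale = markov_seq_measure P k for P :: "(nat \<Rightarrow> 'a::finite) measure" and k +
  fixes f :: "'a list \<Rightarrow> real" and A :: "('q, 'a) dfa" and b :: "'q \<Rightarrow> 'a \<Rightarrow> real"
  assumes martingale: "word_martingale f P L" and generates: "dfa_generates A b L f"
begin

lemma f_nonneg: "\<sigma> \<in> L \<Longrightarrow> 0 \<le> f \<sigma>"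
  using martingale unfolding word_martingale_def by blast

lemma f_snoc: "\<sigma> @ [a] \<in> L \<Longrightarrow> f (\<sigma> @ [a]) = b (dfa_run A \<sigma>) a * f \<sigma>"
  using generates by (simp add: dfa_generates_def)

lemma p_f:
  assumes "\<sigma> \<in> L"
  shows "p \<sigma> * f \<sigma> = (\<Sum>a\<in>UNIV. p (\<sigma> @ [a]) * f (\<sigma> @ [a]))"
proof -
  have "f \<sigma> = (\<Sum>a | \<sigma> @ [a] \<in> L. word_cond_prob P [a] \<sigma> * f (\<sigma> @ [a]))"
    using martingale assms unfolding word_martingale_def by blast
  also have "\<dots> = (\<Sum>a\<in>UNIV. p (\<sigma> @ [a]) / p \<sigma> * f (\<sigma> @ [a]))"
    by (rule sum.mono_neutral_cong_left) (auto simp: word_cond_prob_def notin_L)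
  finally show ?thesis
    using assms by (simp add: sum_distrib_left in_L)
qed

text \<open>The capital changes by factors, so bankruptcy is permanent.\<close>

lemma f_zero_append:
  assumes "f \<sigma> = 0" "\<sigma> @ \<tau> \<in> L"
  shows "f (\<sigma> @ \<tau>) = 0"
  using assms(2)
proof (induction \<tau> rule: rev_induct)
  case (snoc a \<tau>)
  then have "\<sigma> @ \<tau> \<in> L" using L_prefix[of "\<sigma> @ \<tau>" "[a]"] by simp
  then show ?case using snoc f_snoc[of "\<sigma> @ \<tau>" a] by simp
qed (simp add: assms)

section \<open>The killed square root and its decay\<close>

definition trivial :: "'a list \<Rightarrow> bool" where
  "trivial \<sigma> \<longleftrightarrow> (\<forall>\<tau>. \<sigma> @ \<tau> \<in> L \<longrightarrow> f (\<sigma> @ \<tau>) = f \<sigma>)"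

lemma trivial_append: "trivial \<sigma> \<Longrightarrow> \<sigma> @ \<tau> \<in> L \<Longrightarrow> trivial (\<sigma> @ \<tau>)"
  unfolding trivial_def by (metis append.assoc)

text \<open>A bankrupt capital stays 0, hence is constant from then on. So roots at nontrivial words
  may be divided by.\<close>

lemma nontrivial_pos: "\<sigma> \<in> L \<Longrightarrow> \<not> trivial \<sigma> \<Longrightarrow> 0 < f \<sigma>"
  using f_nonneg[of \<sigma>] f_zero_append[of \<sigma>] by (force simp: trivial_def order_le_less)

text \<open>The square root of a martingale is a supermartingale, and it loses a definite proportion of
  its mean as long as there is a genuine bet to come. Killing it once no such bet is left makes its
  mean tend to zero. \<open>mean_root m \<sigma>\<close> is the mean after \<open>m\<close> further steps, restricted to
  \<open>[\<sigma>]\<close>.\<close>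

definition alive_root :: "'a list \<Rightarrow> real" where
  "alive_root \<sigma> = (if \<sigma> \<in> L \<and> \<not> trivial \<sigma> then sqrt (f \<sigma>) else 0)"

definition mean_root :: "nat \<Rightarrow> 'a list \<Rightarrow> real" where
  "mean_root m \<sigma> = (\<Sum>\<tau>\<in>words m. p (\<sigma> @ \<tau>) * alive_root (\<sigma> @ \<tau>))"

lemma alive_root_nonneg [simp]: "0 \<le> alive_root \<sigma>"
  by (simp add: alive_root_def f_nonneg)

lemma alive_root_le: "\<sigma> \<in> L \<Longrightarrow> alive_root \<sigma> \<le> sqrt (f \<sigma>)"
  by (simp add: alive_root_def f_nonneg)

lemma mean_root_0 [simp]: "mean_root 0 \<sigma> = p \<sigma> * alive_root \<sigma>"
proof -
  have "words 0 = {[] :: 'a list}" by auto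
  then show ?thesis by (simp add: mean_root_def)
qed

lemma mean_root_nonneg: "0 \<le> mean_root m \<sigma>"
  by (auto simp: mean_root_def intro!: sum_nonneg)

lemma mean_root_Suc: "mean_root (Suc m) \<sigma> = (\<Sum>a\<in>UNIV. mean_root m (\<sigma> @ [a]))"
  by (simp add: mean_root_def sum_words_Suc_Cons)

lemma mean_root_add: "mean_root (m + n) \<sigma> = (\<Sum>\<tau>\<in>words m. mean_root n (\<sigma> @ \<tau>))"
  by (simp add: mean_root_def sum_words_append)

text \<open>Expand the squares and average with weights \<open>p (\<sigma> @ [a])\<close>;
  \<open>p_f\<close> merges the two quadratic terms. Up to the factor
  \<open>2 * sqrt (f \<sigma>)\<close>, the subtracted sum is the exact loss in the mean of the
  root, and it vanishes only if no symbol of positive probability changes the capital.\<close>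

lemma sqrt_defect:
  assumes "\<sigma> \<in> L"
  shows "2 * sqrt (f \<sigma>) * (\<Sum>a\<in>UNIV. p (\<sigma> @ [a]) * sqrt (f (\<sigma> @ [a])))
    = 2 * (p \<sigma> * f \<sigma>) - (\<Sum>a\<in>UNIV. p (\<sigma> @ [a]) * (sqrt (f \<sigma>) - sqrt (f (\<sigma> @ [a])))\<^sup>2)"
proof -
  have eq: "2 * sqrt (f \<sigma>) * (p (\<sigma> @ [a]) * sqrt (f (\<sigma> @ [a])))
      = p (\<sigma> @ [a]) * f \<sigma> + p (\<sigma> @ [a]) * f (\<sigma> @ [a])
        - p (\<sigma> @ [a]) * (sqrt (f \<sigma>) - sqrt (f (\<sigma> @ [a])))\<^sup>2" for a
  \<comment> \<open>Outside \<open>L\<close> the value of \<open>f\<close> is arbitrary, possibly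
    negative, but its weight is 0.\<close>
  proof (cases "\<sigma> @ [a] \<in> L")
    case True
    then have "(sqrt (f \<sigma>))\<^sup>2 = f \<sigma>" "(sqrt (f (\<sigma> @ [a])))\<^sup>2 = f (\<sigma> @ [a])"
      using assms f_nonneg by auto
    then show ?thesis by (simp add: power2_diff algebra_simps)
  qed (simp add: notin_L)
  have "(\<Sum>a\<in>UNIV. p (\<sigma> @ [a]) * f \<sigma>) = p \<sigma> * f \<sigma>"
    by (simp add: p_snoc[of \<sigma>] sum_distrib_right)
  then show ?thesis
    by (simp add: sum_distrib_left eq sum.distrib sum_subtractf p_f[OF assms])
qed

text \<open>Dropping the squares in \<open>sqrt_defect\<close> settles the unkilled root, and
  killing only lowers the left side. If \<open>\<sigma>\<close> is killed or outside
  \<open>L\<close>, every extension contributes 0.\<close>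

lemma mean_root_1_le: "(\<Sum>a\<in>UNIV. p (\<sigma> @ [a]) * alive_root (\<sigma> @ [a])) \<le> p \<sigma> * alive_root \<sigma>"
proof (cases "\<sigma> \<in> L \<and> \<not> trivial \<sigma>")
  case True
  then have pos: "0 < f \<sigma>" using nontrivial_pos by blast
  have "(\<Sum>a\<in>UNIV. p (\<sigma> @ [a]) * alive_root (\<sigma> @ [a])) \<le> (\<Sum>a\<in>UNIV. p (\<sigma> @ [a]) * sqrt (f (\<sigma> @ [a])))"
    using alive_root_le notin_L by (intro sum_mono) (metis mult_left_mono mult_zero_left order_refl p_nonneg)
  then have "2 * sqrt (f \<sigma>) * (\<Sum>a\<in>UNIV. p (\<sigma> @ [a]) * alive_root (\<sigma> @ [a]))
      \<le> 2 * sqrt (f \<sigma>) * (\<Sum>a\<in>UNIV. p (\<sigma> @ [a]) * sqrt (f (\<sigma> @ [a])))"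
    using pos by (intro mult_left_mono) auto
  also have "\<dots> \<le> 2 * (p \<sigma> * f \<sigma>)"
    using True by (subst sqrt_defect) (auto intro!: sum_nonneg)
  also have "\<dots> = 2 * sqrt (f \<sigma>) * (p \<sigma> * alive_root \<sigma>)"
    using True pos by (simp add: alive_root_def)
  finally show ?thesis using pos by simp
next
  case False
  then have "p (\<sigma> @ [a]) * alive_root (\<sigma> @ [a]) = 0" for a
    using trivial_append[of \<sigma> "[a]"] L_prefix[of \<sigma> "[a]"] by (auto simp: alive_root_def)
  then show ?thesis by (subst sum.neutral) (auto simp del: mult_eq_0_iff)
qed

lemma mean_root_Suc_le: "mean_root (Suc m) \<sigma> \<le> mean_root m \<sigma>"
proof -
  have "mean_root (Suc m) \<sigma> = (\<Sum>\<tau>\<in>words m. mean_root 1 (\<sigma> @ \<tau>))"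
    using mean_root_add[of m 1] by simp
  also have "\<dots> \<le> mean_root m \<sigma>"
    unfolding mean_root_def[of m] using mean_root_1_le
    by (intro sum_mono) (simp only: One_nat_def mean_root_Suc mean_root_0)
  finally show ?thesis .
qed

lemma mean_root_antimono: "m \<le> n \<Longrightarrow> mean_root n \<sigma> \<le> mean_root m \<sigma>"
  by (rule lift_Suc_antimono_le[of "\<lambda>m. mean_root m \<sigma>"]) (rule mean_root_Suc_le)

lemma mean_root_le: "mean_root m \<sigma> \<le> p \<sigma> * alive_root \<sigma>"
  using mean_root_antimono[of 0 m \<sigma>] by simp

text \<open>If the first step loses nothing, all squares in \<open>sqrt_defect\<close> vanish and
  nothing is killed. Absence of later losses passes to each child, because the means of the children
  add up and each is bounded separately.\<close>

lemma mean_root_const_step: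
  assumes \<sigma>: "\<sigma> \<in> L" "\<not> trivial \<sigma>" and const: "\<And>m. mean_root m \<sigma> = p \<sigma> * alive_root \<sigma>"
    and a: "\<sigma> @ [a] \<in> L"
  shows "f (\<sigma> @ [a]) = f \<sigma>" "\<not> trivial (\<sigma> @ [a])"
    "mean_root m (\<sigma> @ [a]) = p (\<sigma> @ [a]) * alive_root (\<sigma> @ [a])"
proof -
  let ?p = "\<lambda>a. p (\<sigma> @ [a])" and ?Z = "\<lambda>a. alive_root (\<sigma> @ [a])"
  have pos: "0 < f \<sigma>" using nontrivial_pos \<sigma> by blast
  have Z: "(\<Sum>a\<in>UNIV. ?p a * ?Z a) = p \<sigma> * sqrt (f \<sigma>)"
    using const[of "Suc 0"] \<sigma> by (simp only: mean_root_Suc mean_root_0 alive_root_def if_True) simp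
  have le: "?p a * ?Z a \<le> ?p a * sqrt (f (\<sigma> @ [a]))" for a
    using alive_root_le notin_L by (metis mult_left_mono mult_zero_left order_refl p_nonneg)
  have "2 * sqrt (f \<sigma>) * (p \<sigma> * sqrt (f \<sigma>))
      \<le> 2 * sqrt (f \<sigma>) * (\<Sum>a\<in>UNIV. ?p a * sqrt (f (\<sigma> @ [a])))"
    unfolding Z[symmetric] using pos by (intro mult_left_mono sum_mono le) auto
  moreover have "2 * sqrt (f \<sigma>) * (p \<sigma> * sqrt (f \<sigma>)) = 2 * (p \<sigma> * f \<sigma>)"
  proof -
    have "2 * sqrt (f \<sigma>) * (p \<sigma> * sqrt (f \<sigma>)) = 2 * (p \<sigma> * (sqrt (f \<sigma>) * sqrt (f \<sigma>)))"
      by (simp add: algebra_simps)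
    then show ?thesis using pos by simp
  qed
  ultimately have "(\<Sum>a\<in>UNIV. ?p a * (sqrt (f \<sigma>) - sqrt (f (\<sigma> @ [a])))\<^sup>2) \<le> 0"
    unfolding sqrt_defect[OF \<sigma>(1)] by linarith
  then have "(\<Sum>a\<in>UNIV. ?p a * (sqrt (f \<sigma>) - sqrt (f (\<sigma> @ [a])))\<^sup>2) = 0"
    by (intro order_antisym sum_nonneg) auto
  then have "?p a * (sqrt (f \<sigma>) - sqrt (f (\<sigma> @ [a])))\<^sup>2 = 0" for a
    by (subst (asm) sum_nonneg_eq_0_iff) auto
  then have f_eq: "f (\<sigma> @ [a]) = f \<sigma>" if "\<sigma> @ [a] \<in> L" for a
    using that by (simp add: in_L) (metis less_irrefl)
  then show "f (\<sigma> @ [a]) = f \<sigma>" using a by blast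
  \<comment> \<open>Equal sums of termwise comparable terms force equality of each term.\<close>
  have "?p x * ?Z x = ?p x * sqrt (f \<sigma>)" for x
  proof (rule sum_mono_inv[where I = UNIV and f = "\<lambda>x. ?p x * ?Z x"])
    show "(\<Sum>a\<in>UNIV. ?p a * ?Z a) = (\<Sum>a\<in>UNIV. ?p a * sqrt (f \<sigma>))"
      unfolding Z by (simp add: p_snoc[of \<sigma>] sum_distrib_right)
    show "?p x * ?Z x \<le> ?p x * sqrt (f \<sigma>)" for x
      using le[of x] f_eq[of x] by (cases "\<sigma> @ [x] \<in> L") (auto simp: notin_L)
  qed auto
  from this[of a] have "?Z a = sqrt (f \<sigma>)" using a by (simp add: in_L)
  then show "\<not> trivial (\<sigma> @ [a])" using pos by (auto simp: alive_root_def)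
  show "mean_root m (\<sigma> @ [a]) = ?p a * ?Z a"
  proof (rule sum_mono_inv[where I = UNIV and f = "\<lambda>a. mean_root m (\<sigma> @ [a])"])
    show "(\<Sum>a\<in>UNIV. mean_root m (\<sigma> @ [a])) = (\<Sum>a\<in>UNIV. ?p a * ?Z a)"
      using const[of "Suc m"] const[of "Suc 0"] by (simp only: mean_root_Suc mean_root_0)
  qed (auto simp: mean_root_le)
qed

text \<open>Losslessness is inherited by all extensions in \<open>L\<close>, and the capital never
  changes along them; but that is triviality.\<close>

lemma mean_root_strict:
  assumes "\<sigma> \<in> L" "\<not> trivial \<sigma>"
  shows "\<exists>m. mean_root m \<sigma> < p \<sigma> * alive_root \<sigma>"
proof (rule ccontr)
  assume "\<not> ?thesis"
  then have const: "mean_root m \<sigma> = p \<sigma> * alive_root \<sigma>" for m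
    using mean_root_le[of m \<sigma>] by (metis order_le_less)
  have "f (\<sigma> @ \<tau>) = f \<sigma> \<and> \<not> trivial (\<sigma> @ \<tau>) \<and>
      (\<forall>m. mean_root m (\<sigma> @ \<tau>) = p (\<sigma> @ \<tau>) * alive_root (\<sigma> @ \<tau>))" if "\<sigma> @ \<tau> \<in> L" for \<tau>
    using that
  proof (induction \<tau> rule: rev_induct)
    case (snoc a \<tau>)
    have "\<sigma> @ \<tau> \<in> L" using snoc.prems L_prefix[of "\<sigma> @ \<tau>" "[a]"] by simp
    then show ?case
      using snoc mean_root_const_step[of "\<sigma> @ \<tau>" a] by simp
  qed (use assms const in simp)
  then have "trivial \<sigma>" by (simp add: trivial_def)
  with assms show False by simp
qed

section \<open>Finitely many states of play\<close>

definition positive_words :: "'a list set" where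
  "positive_words = {\<sigma> \<in> L. k \<le> length \<sigma> \<and> 0 < f \<sigma>}"

text \<open>On \<open>positive_words\<close> this pair determines the whole future of the game
  relative to the current probability and capital: length at least \<open>k\<close> makes the Markov
  property applicable, and positive capital makes the ratios meaningful.\<close>

definition state_class :: "'a list \<Rightarrow> 'q \<times> 'a list" where
  "state_class \<sigma> = (dfa_run A \<sigma>, last_symbols k \<sigma>)"

lemma run_in_states: "dfa_run A \<sigma> \<in> dfa_states A"
  using generates by (induction \<sigma> rule: rev_induct) (auto simp: dfa_run_def dfa_generates_def is_dfa_def)

lemma finite_states: "finite (dfa_states A)"
  using generates by (simp add: dfa_generates_def is_dfa_def)

lemma finite_classes: "finite (state_class ` positive_words)"
proof (rule finite_subset)
  show "state_class ` positive_words \<subseteq> dfa_states A \<times> words k"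
    by (auto simp: positive_words_def state_class_def run_in_states)
qed (simp add: finite_states)

context
  fixes \<sigma> \<sigma>'
  assumes pos: "\<sigma> \<in> positive_words" "\<sigma>' \<in> positive_words" and cls: "state_class \<sigma> = state_class \<sigma>'"
begin

lemma class_p: "p (\<sigma> @ \<tau>) / p \<sigma> = p (\<sigma>' @ \<tau>) / p \<sigma>'"
  using pos cls by (intro cond_cong) (auto simp: positive_words_def state_class_def)

lemma class_L: "\<sigma> @ \<tau> \<in> L \<longleftrightarrow> \<sigma>' @ \<tau> \<in> L"
  using class_p[of \<tau>] pos notin_L[of "\<sigma> @ \<tau>"] notin_L[of "\<sigma>' @ \<tau>"]
  by (auto simp: positive_words_def in_L)

text \<open>Equal automaton states stay equal while the same word is read, so both capitals are
  multiplied by the same values of \<open>b\<close>.\<close>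

lemma class_f:
  assumes "\<sigma> @ \<tau> \<in> L"
  shows "f (\<sigma> @ \<tau>) / f \<sigma> = f (\<sigma>' @ \<tau>) / f \<sigma>'"
  using assms
proof (induction \<tau> rule: rev_induct)
  case Nil
  then show ?case using pos by (simp add: positive_words_def)
next
  case (snoc a \<tau>)
  have "\<sigma> @ \<tau> \<in> L" using snoc.prems L_prefix[of "\<sigma> @ \<tau>" "[a]"] by simp
  moreover have "\<sigma>' @ \<tau> @ [a] \<in> L" using snoc.prems class_L by blast
  moreover have "dfa_run A (\<sigma> @ \<tau>) = dfa_run A (\<sigma>' @ \<tau>)"
    using cls by (simp add: dfa_run_append state_class_def)
  ultimately show ?case
    using snoc f_snoc[of "\<sigma> @ \<tau>" a] f_snoc[of "\<sigma>' @ \<tau>" a] by (simp flip: times_divide_eq_right)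
qed

text \<open>Constancy of the capital can be read off its ratios to the current capital, which
  \<open>class_f\<close> identifies.\<close>

lemma class_trivial:
  assumes "\<sigma> @ \<tau> \<in> L"
  shows "trivial (\<sigma> @ \<tau>) \<longleftrightarrow> trivial (\<sigma>' @ \<tau>)"
proof -
  have fp: "f \<sigma> > 0" "f \<sigma>' > 0" using pos by (auto simp: positive_words_def)
  have "f (\<sigma> @ \<tau> @ \<rho>) = f (\<sigma> @ \<tau>) \<longleftrightarrow> f (\<sigma>' @ \<tau> @ \<rho>) = f (\<sigma>' @ \<tau>)"
    if "\<sigma> @ \<tau> @ \<rho> \<in> L" for \<rho>
  proof -
    have "f (\<sigma> @ \<tau> @ \<rho>) = f (\<sigma> @ \<tau>) \<longleftrightarrow> f (\<sigma> @ \<tau> @ \<rho>) / f \<sigma> = f (\<sigma> @ \<tau>) / f \<sigma>"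
      using fp by simp
    also have "\<dots> \<longleftrightarrow> f (\<sigma>' @ \<tau> @ \<rho>) / f \<sigma>' = f (\<sigma>' @ \<tau>) / f \<sigma>'"
      using class_f[OF that] class_f[OF assms] by simp
    also have "\<dots> \<longleftrightarrow> f (\<sigma>' @ \<tau> @ \<rho>) = f (\<sigma>' @ \<tau>)" using fp by simp
    finally show ?thesis .
  qed
  then show ?thesis unfolding trivial_def using class_L by auto
qed

lemma class_root: "alive_root (\<sigma> @ \<tau>) / sqrt (f \<sigma>) = alive_root (\<sigma>' @ \<tau>) / sqrt (f \<sigma>')"
  using class_L[of \<tau>] class_trivial[of \<tau>] class_f[of \<tau>]
  by (auto simp: alive_root_def simp flip: real_sqrt_divide)

lemma class_mean_root:
  "mean_root m \<sigma> / (p \<sigma> * sqrt (f \<sigma>)) = mean_root m \<sigma>' / (p \<sigma>' * sqrt (f \<sigma>'))"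
proof -
  have "mean_root m \<sigma> / (p \<sigma> * sqrt (f \<sigma>))
      = (\<Sum>\<tau>\<in>words m. (p (\<sigma> @ \<tau>) / p \<sigma>) * (alive_root (\<sigma> @ \<tau>) / sqrt (f \<sigma>)))"
    by (simp add: mean_root_def sum_divide_distrib)
  also have "\<dots> = mean_root m \<sigma>' / (p \<sigma>' * sqrt (f \<sigma>'))"
    unfolding class_p class_root by (simp add: mean_root_def sum_divide_distrib)
  finally show ?thesis .
qed

end

text \<open>The normalised mean root is constant on a class, so the strict loss at one
  representative yields one factor for all members. In a trivial class the root is already
  0.\<close>

lemma mean_root_class_contraction:
  assumes "\<sigma>' \<in> positive_words"
  shows "\<exists>m \<theta>. 0 \<le> \<theta> \<and> \<theta> < 1 \<and> (\<forall>\<sigma>\<in>positive_words. state_class \<sigma> = state_class \<sigma>' \<longrightarrow>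
    mean_root m \<sigma> \<le> \<theta> * (p \<sigma> * alive_root \<sigma>))"
proof (cases "trivial \<sigma>'")
  case True
  have "mean_root 0 \<sigma> \<le> 0 * (p \<sigma> * alive_root \<sigma>)"
    if "\<sigma> \<in> positive_words" "state_class \<sigma> = state_class \<sigma>'" for \<sigma>
    using class_trivial[OF that(1) assms that(2), of "[]"] True that
    by (auto simp: alive_root_def positive_words_def)
  then show ?thesis by (intro exI[of _ 0] exI[of _ "0::real"]) auto
next
  case False
  have \<sigma>': "\<sigma>' \<in> L" "0 < f \<sigma>'" "0 < p \<sigma>'" using assms by (auto simp: positive_words_def in_L)
  obtain m where m: "mean_root m \<sigma>' < p \<sigma>' * alive_root \<sigma>'"
    using mean_root_strict[OF \<sigma>'(1) False] by blast
  define \<theta> where "\<theta> = mean_root m \<sigma>' / (p \<sigma>' * sqrt (f \<sigma>'))"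
  have "0 \<le> \<theta>" using \<sigma>' mean_root_nonneg by (simp add: \<theta>_def)
  moreover have "\<theta> < 1" using m \<sigma>' False by (simp add: \<theta>_def alive_root_def)
  moreover have "mean_root m \<sigma> \<le> \<theta> * (p \<sigma> * alive_root \<sigma>)"
    if "\<sigma> \<in> positive_words" "state_class \<sigma> = state_class \<sigma>'" for \<sigma>
  proof -
    have \<sigma>: "\<sigma> \<in> L" "0 < f \<sigma>" "0 < p \<sigma>" using that by (auto simp: positive_words_def in_L)
    moreover have "\<not> trivial \<sigma>"
      using class_trivial[OF that(1) assms that(2), of "[]"] False \<sigma> by simp
    ultimately have "alive_root \<sigma> = sqrt (f \<sigma>)" by (simp add: alive_root_def)
    then show ?thesis
      using class_mean_root[OF that(1) assms that(2), of m] \<sigma> unfolding \<theta>_def[symmetric]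
      by (simp add: divide_simps split: if_splits)
  qed
  ultimately show ?thesis by blast
qed

text \<open>Over finitely many classes take the largest \<open>m\<close> and the largest factor; by
  antimonotonicity a longer block does no harm. At the remaining words the right side is 0, since
  either \<open>p\<close> vanishes or the capital is 0 and thus killed.\<close>

lemma mean_root_contraction:
  obtains m \<theta> where "0 \<le> \<theta>" "\<theta> < 1"
    "\<And>\<sigma>. k \<le> length \<sigma> \<Longrightarrow> mean_root m \<sigma> \<le> \<theta> * (p \<sigma> * alive_root \<sigma>)"
proof -
  have "\<exists>m \<theta>. 0 \<le> \<theta> \<and> \<theta> < 1 \<and>
      (\<forall>\<sigma>\<in>positive_words. state_class \<sigma> \<in> C \<longrightarrow> mean_root m \<sigma> \<le> \<theta> * (p \<sigma> * alive_root \<sigma>))"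
    if "finite C" "C \<subseteq> state_class ` positive_words" for C
    using that
  proof (induction C rule: finite_induct)
    case empty
    then show ?case by (intro exI[of _ 0] exI[of _ "0::real"]) auto
  next
    case (insert c C)
    from insert obtain m \<theta> where 1: "0 \<le> \<theta>" "\<theta> < 1"
      "\<And>\<sigma>. \<sigma> \<in> positive_words \<Longrightarrow> state_class \<sigma> \<in> C \<Longrightarrow> mean_root m \<sigma> \<le> \<theta> * (p \<sigma> * alive_root \<sigma>)"
      by auto
    from insert.prems obtain m' \<theta>' where 2: "0 \<le> \<theta>'" "\<theta>' < 1"
      "\<And>\<sigma>. \<sigma> \<in> positive_words \<Longrightarrow> state_class \<sigma> = c \<Longrightarrow> mean_root m' \<sigma> \<le> \<theta>' * (p \<sigma> * alive_root \<sigma>)"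
    proof -
      obtain \<sigma>' where \<sigma>': "\<sigma>' \<in> positive_words" "c = state_class \<sigma>'" using insert.prems by auto
      then show thesis using that mean_root_class_contraction[OF \<sigma>'(1)] by blast
    qed
    have "mean_root (max m m') \<sigma> \<le> max \<theta> \<theta>' * (p \<sigma> * alive_root \<sigma>)"
      if "\<sigma> \<in> positive_words" "state_class \<sigma> \<in> insert c C" for \<sigma>
    proof -
      have "mean_root m \<sigma> \<le> \<theta> * (p \<sigma> * alive_root \<sigma>) \<or> mean_root m' \<sigma> \<le> \<theta>' * (p \<sigma> * alive_root \<sigma>)"
        using 1(3) 2(3) that by blast
      moreover have "\<theta> * (p \<sigma> * alive_root \<sigma>) \<le> max \<theta> \<theta>' * (p \<sigma> * alive_root \<sigma>)"
        "\<theta>' * (p \<sigma> * alive_root \<sigma>) \<le> max \<theta> \<theta>' * (p \<sigma> * alive_root \<sigma>)"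
        by (auto intro!: mult_right_mono)
      ultimately show ?thesis
        using mean_root_antimono[of m "max m m'" \<sigma>] mean_root_antimono[of m' "max m m'" \<sigma>] by fastforce
    qed
    then show ?case
      using 1 2 by (intro exI[of _ "max m m'"] exI[of _ "max \<theta> \<theta>'"]) auto
  qed
  from this[OF finite_classes order_refl] obtain m \<theta> where \<theta>: "0 \<le> \<theta>" "\<theta> < 1"
    "\<And>\<sigma>. \<sigma> \<in> positive_words \<Longrightarrow> mean_root m \<sigma> \<le> \<theta> * (p \<sigma> * alive_root \<sigma>)"
    by blast
  have "mean_root m \<sigma> \<le> \<theta> * (p \<sigma> * alive_root \<sigma>)" if "k \<le> length \<sigma>" for \<sigma>
  proof (cases "\<sigma> \<in> positive_words")
    case False
    then have 0: "p \<sigma> * alive_root \<sigma> = 0"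
      using that nontrivial_pos[of \<sigma>] by (auto simp: positive_words_def alive_root_def)
    show ?thesis using mean_root_le[of m \<sigma>] unfolding 0 by simp
  qed (rule \<theta>)
  with \<theta> that show thesis by blast
qed

lemma mean_root_small:
  assumes "0 < \<eta>"
  obtains m where "0 < m" "\<And>\<sigma>. k \<le> length \<sigma> \<Longrightarrow> mean_root m \<sigma> \<le> \<eta> * (p \<sigma> * alive_root \<sigma>)"
proof -
  obtain m \<theta> where \<theta>: "0 \<le> \<theta>" "\<theta> < 1"
    "\<And>\<sigma>. k \<le> length \<sigma> \<Longrightarrow> mean_root m \<sigma> \<le> \<theta> * (p \<sigma> * alive_root \<sigma>)"
    by (rule mean_root_contraction) blast
  have pow: "mean_root (j * m) \<sigma> \<le> \<theta> ^ j * (p \<sigma> * alive_root \<sigma>)" if "k \<le> length \<sigma>" for j \<sigma>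
  proof (induction j)
    case (Suc j)
    have "mean_root (Suc j * m) \<sigma> = (\<Sum>\<tau>\<in>words (j * m). mean_root m (\<sigma> @ \<tau>))"
      using mean_root_add[of "j * m" m \<sigma>] by (simp add: add.commute)
    also have "\<dots> \<le> (\<Sum>\<tau>\<in>words (j * m). \<theta> * (p (\<sigma> @ \<tau>) * alive_root (\<sigma> @ \<tau>)))"
      using that by (intro sum_mono \<theta>(3)) auto
    also have "\<dots> = \<theta> * mean_root (j * m) \<sigma>"
      by (simp add: mean_root_def sum_distrib_left)
    also have "\<dots> \<le> \<theta> * (\<theta> ^ j * (p \<sigma> * alive_root \<sigma>))"
      by (rule mult_left_mono[OF Suc \<theta>(1)])
    finally show ?case by simp
  qed simp
  obtain j where j: "\<theta> ^ j < \<eta>"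
    using real_arch_pow_inv[OF assms \<theta>(2)] by blast
  \<comment> \<open>The successor keeps the block length positive even if \<open>j * m\<close> is
    0.\<close>
  have "mean_root (Suc (j * m)) \<sigma> \<le> \<eta> * (p \<sigma> * alive_root \<sigma>)" if "k \<le> length \<sigma>" for \<sigma>
  proof -
    have "mean_root (Suc (j * m)) \<sigma> \<le> \<theta> ^ j * (p \<sigma> * alive_root \<sigma>)"
      using mean_root_Suc_le pow[OF that] by (rule order_trans)
    also have "\<dots> \<le> \<eta> * (p \<sigma> * alive_root \<sigma>)"
      using j by (intro mult_right_mono) auto
    finally show ?thesis .
  qed
  then show thesis by (rule that[of "Suc (j * m)", rotated]) auto
qed

section \<open>The capital along a distributed sequence\<close>

lemma f_growth:
  obtains B where "1 \<le> B" "\<And>\<sigma> a. \<sigma> @ [a] \<in> L \<Longrightarrow> f (\<sigma> @ [a]) \<le> B * f \<sigma>"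
proof -
  define B where "B = 1 + (\<Sum>q\<in>dfa_states A. \<Sum>a\<in>UNIV. \<bar>b q a\<bar>)"
  have "f (\<sigma> @ [a]) \<le> B * f \<sigma>" if "\<sigma> @ [a] \<in> L" for \<sigma> a
  proof -
    have "\<bar>b (dfa_run A \<sigma>) a\<bar> \<le> (\<Sum>a\<in>UNIV. \<bar>b (dfa_run A \<sigma>) a\<bar>)"
      by (rule member_le_sum) auto
    also have "\<dots> \<le> (\<Sum>q\<in>dfa_states A. \<Sum>a\<in>UNIV. \<bar>b q a\<bar>)"
      by (rule member_le_sum[of _ _ "\<lambda>q. \<Sum>a\<in>UNIV. \<bar>b q a\<bar>"])
         (auto simp: run_in_states finite_states intro: sum_nonneg)
    finally have "b (dfa_run A \<sigma>) a \<le> B" by (simp add: B_def)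
    then show ?thesis
      unfolding f_snoc[OF that] using f_nonneg[OF L_prefix[OF that]] by (rule mult_right_mono)
  qed
  moreover have "1 \<le> B" by (simp add: B_def sum_nonneg)
  ultimately show thesis by (rule that[rotated])
qed

text \<open>By the Markov property, what follows the last \<open>k\<close> symbols of
  \<open>\<sigma>\<close> has the same law as what follows \<open>\<sigma>\<close>. Hence the
  stationary mean of this window function is the probability of those \<open>k\<close> symbols times
  the normalised mean root.\<close>

lemma mean_window_root:
  assumes r: "\<sigma> \<in> positive_words"
  shows "(\<Sum>v\<in>words (k + m). p v *
      (if take k v = last_symbols k \<sigma> then alive_root (\<sigma> @ drop k v) / sqrt (f \<sigma>) else 0))
    = p (last_symbols k \<sigma>) * (mean_root m \<sigma> / (p \<sigma> * sqrt (f \<sigma>)))"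
proof -
  let ?w = "last_symbols k \<sigma>"
  have \<sigma>: "\<sigma> \<in> L" "k \<le> length \<sigma>" "0 < p \<sigma>" using r by (auto simp: positive_words_def in_L)
  have "(\<Sum>v\<in>words (k + m). p v *
      (if take k v = ?w then alive_root (\<sigma> @ drop k v) / sqrt (f \<sigma>) else 0))
    = (\<Sum>w\<in>words k. \<Sum>\<tau>\<in>words m. p (w @ \<tau>) *
      (if w = ?w then alive_root (\<sigma> @ \<tau>) / sqrt (f \<sigma>) else 0))"
    unfolding sum_words_append using \<sigma>(2) by (intro sum.cong refl) (simp add: min_absorb1)
  also have "\<dots> = (\<Sum>w\<in>words k. if w = ?w then
      \<Sum>\<tau>\<in>words m. p (w @ \<tau>) * (alive_root (\<sigma> @ \<tau>) / sqrt (f \<sigma>)) else 0)"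
    by (intro sum.cong) auto
  also have "\<dots> = (\<Sum>\<tau>\<in>words m. p (?w @ \<tau>) * (alive_root (\<sigma> @ \<tau>) / sqrt (f \<sigma>)))"
    using \<sigma> by simp
  also have "\<dots> = (\<Sum>\<tau>\<in>words m. p ?w * (p (\<sigma> @ \<tau>) * alive_root (\<sigma> @ \<tau>) / (p \<sigma> * sqrt (f \<sigma>))))"
  proof (rule sum.cong[OF refl])
    fix \<tau>
    have "p (?w @ \<tau>) = p ?w * (p (\<sigma> @ \<tau>) / p \<sigma>)"
      unfolding cond_last_symbols[OF \<sigma>(1,2)] using p_last_symbols_pos[OF \<sigma>(1), of k] by simp
    then show "p (?w @ \<tau>) * (alive_root (\<sigma> @ \<tau>) / sqrt (f \<sigma>))
        = p ?w * (p (\<sigma> @ \<tau>) * alive_root (\<sigma> @ \<tau>) / (p \<sigma> * sqrt (f \<sigma>)))"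
      by simp
  qed
  also have "\<dots> = p ?w * (mean_root m \<sigma> / (p \<sigma> * sqrt (f \<sigma>)))"
    by (simp add: mean_root_def sum_distrib_left sum_divide_distrib)
  finally show ?thesis .
qed

lemma distributed_imp_bounded:
  assumes dist: "distributed_seq P s" and s: "\<And>N. seq_prefix N s \<in> L"
  shows "\<exists>M. \<forall>N. f (seq_prefix N s) \<le> M"
\<comment> \<open>If betting stops along \<open>s\<close>, the capital is eventually constant.
  Otherwise it is positive at all times and has a logarithm.\<close>
proof (cases "\<exists>N. trivial (seq_prefix N s)")
  case True
  then obtain N where N: "trivial (seq_prefix N s)" by blast
  have const: "f (seq_prefix n s) = f (seq_prefix N s)" if "N \<le> n" for n
    using N s[of n] that seq_prefix_add[of N "n - N" s] by (simp add: trivial_def)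
  have "f (seq_prefix n s) \<le> (\<Sum>i\<le>N. f (seq_prefix i s))" for n
  proof -
    have "f (seq_prefix (min n N) s) \<le> (\<Sum>i\<le>N. f (seq_prefix i s))"
      by (rule member_le_sum) (auto simp: f_nonneg s)
    then show ?thesis using const[of n] by (auto simp: min_def split: if_splits)
  qed
  then show ?thesis by blast
next
  case False
  define F where "F n = f (seq_prefix n s)" for n
  have F_pos: "0 < F n" for n
    using False nontrivial_pos s by (simp add: F_def)
  have root_F: "alive_root (seq_prefix n s) = sqrt (F n)" for n
    using False s by (simp add: F_def alive_root_def)
  have pos: "seq_prefix n s \<in> positive_words" if "k \<le> n" for n
    using that s F_pos by (simp add: positive_words_def F_def)
  define C where "C = state_class ` positive_words"
  have C: "finite C" "0 < card C"
    using finite_classes pos[of k] by (auto simp: C_def card_gt_0_iff)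
  define rep where "rep = inv_into positive_words state_class"
  have rep: "rep c \<in> positive_words" "state_class (rep c) = c" if "c \<in> C" for c
    using that by (auto simp: rep_def C_def inv_into_into f_inv_into_f)
  have rep_pos: "0 < f (rep c)" "0 < p (rep c)" "rep c \<in> L" "k \<le> length (rep c)" if "c \<in> C" for c
    using rep(1)[OF that] by (auto simp: positive_words_def in_L)
  \<comment> \<open>Each class may contribute at most \<open>1 / (2 * real (card C))\<close>, so
    that the sum over all classes has mean at most 1/2.\<close>
  obtain m where "0 < m"
    and m: "\<And>\<sigma>. k \<le> length \<sigma> \<Longrightarrow> mean_root m \<sigma> \<le> 1 / (2 * real (card C)) * (p \<sigma> * alive_root \<sigma>)"
    using mean_root_small[of "1 / (2 * real (card C))"] C by auto
  \<comment> \<open>\<open>H \<sigma> v\<close> is the factor gained by the root over the last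
    \<open>m\<close> symbols of \<open>v\<close> if play enters them in the class of
    \<open>\<sigma>\<close>; \<open>G\<close> adds these up because the window does not reveal the
    automaton state.\<close>
  define H where "H \<sigma> v = (if take k v = last_symbols k \<sigma> then alive_root (\<sigma> @ drop k v) / sqrt (f \<sigma>) else 0)"
    for \<sigma> v
  define G where "G v = (\<Sum>c\<in>C. H (rep c) v)" for v
  \<comment> \<open>The class actually current is one of the summands, its representative has the
    same ratio of roots, and the other summands are nonnegative.\<close>
  have ratio: "sqrt (F (k + i + m)) / sqrt (F (k + i)) \<le> G (map s [i..<i + (k + m)])" for i
  proof -
    let ?\<sigma> = "seq_prefix (k + i) s" and ?v = "map s [i..<i + (k + m)]"
    let ?c = "state_class ?\<sigma>"
    have c: "?c \<in> C" by (simp add: C_def pos)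
    have v: "?v = map s [i..<i + k] @ map s [k + i..<k + i + m]"
      unfolding map_append[symmetric] using upt_add_eq_append[of i "i + k" m] by (simp add: ac_simps)
    have "last_symbols k (rep ?c) = snd ?c" using rep(2)[OF c] by (metis snd_conv state_class_def)
    also have "\<dots> = map s [i..<i + k]"
      by (simp add: state_class_def last_symbols_prefix add.commute)
    finally have "H (rep ?c) ?v = alive_root (rep ?c @ map s [k + i..<k + i + m]) / sqrt (f (rep ?c))"
      unfolding v by (simp add: H_def)
    also have "\<dots> = alive_root (?\<sigma> @ map s [k + i..<k + i + m]) / sqrt (f ?\<sigma>)"
      by (rule class_root) (use rep[OF c] pos in auto)
    also have "\<dots> = sqrt (F (k + i + m)) / sqrt (F (k + i))"
      unfolding seq_prefix_add[symmetric] root_F by (simp add: F_def)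
    finally have "sqrt (F (k + i + m)) / sqrt (F (k + i)) = H (rep ?c) ?v" by simp
    also have "\<dots> \<le> G ?v"
      unfolding G_def by (rule member_le_sum[OF c]) (use C in \<open>auto simp: H_def rep_pos less_imp_le\<close>)
    finally show ?thesis .
  qed
  have "(\<Sum>v\<in>words (k + m). p v * G v) = (\<Sum>c\<in>C. \<Sum>v\<in>words (k + m). p v * H (rep c) v)"
    unfolding G_def sum_distrib_left by (rule sum.swap)
  also have "\<dots> \<le> (\<Sum>c\<in>C. 1 / (2 * real (card C)))"
  proof (rule sum_mono)
    fix c assume c: "c \<in> C"
    note r = rep_pos[OF c]
    have "mean_root m (rep c) / (p (rep c) * sqrt (f (rep c)))
        \<le> 1 / (2 * real (card C)) * (p (rep c) * alive_root (rep c)) / (p (rep c) * sqrt (f (rep c)))"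
      using m[OF r(4)] r by (intro divide_right_mono) auto
    also have "\<dots> \<le> 1 / (2 * real (card C))"
      using alive_root_le[OF r(3)] r C by (simp add: divide_simps)
    finally have le: "mean_root m (rep c) / (p (rep c) * sqrt (f (rep c))) \<le> 1 / (2 * real (card C))" .
    have "(\<Sum>v\<in>words (k + m). p v * H (rep c) v)
        = p (last_symbols k (rep c)) * (mean_root m (rep c) / (p (rep c) * sqrt (f (rep c))))"
      unfolding H_def by (rule mean_window_root[OF rep(1)[OF c]])
    also have "\<dots> \<le> 1 * (1 / (2 * real (card C)))"
      using le mean_root_nonneg r by (intro mult_mono) (auto simp: word_prob_def)
    finally show "(\<Sum>v\<in>words (k + m). p v * H (rep c) v) \<le> 1 / (2 * real (card C))" by simp
  qed
  also have "\<dots> = 1 / 2" using C by (simp add: card_gt_0_iff)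
  finally have "(\<Sum>v\<in>words (k + m). p v * G v) < 1" by simp
  from order_tendstoD(2)[OF distributed_average[OF dist, of G "k + m"] this]
  obtain N0 where N0: "\<And>N. N0 \<le> N \<Longrightarrow> 1 / real N * (\<Sum>i<N. G (map s [i..<i + (k + m)])) < 1"
    unfolding eventually_sequentially by blast
  obtain B where B: "1 \<le> B" "\<And>\<sigma> a. \<sigma> @ [a] \<in> L \<Longrightarrow> f (\<sigma> @ [a]) \<le> B * f \<sigma>"
    by (rule f_growth) blast
  \<comment> \<open>Telescoping bounds only a sum of \<open>m\<close> consecutive logarithms; this
    one-sided growth bound passes from that sum to a single time.\<close>
  have ln_step: "ln (F (n + j)) \<le> ln (F n) + real j * ln B" for n j
  proof (induction j)
    case (Suc j)
    have "F (Suc (n + j)) \<le> B * F (n + j)"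
      using B(2) s[of "Suc (n + j)"] by (simp add: F_def seq_prefix_Suc)
    then have "ln (F (Suc (n + j))) \<le> ln (B * F (n + j))"
      using F_pos B(1) by (simp add: ln_le_cancel_iff)
    also have "\<dots> = ln B + ln (F (n + j))" using F_pos[of "n + j"] B(1) by (subst ln_mult) auto
    finally show ?case using Suc by (simp add: algebra_simps)
  qed simp
  define K where "K = (\<Sum>i<m. ln (F (k + i))) + real m * (real m * ln B)"
  \<comment> \<open>\<open>N0 + 1\<close> keeps \<open>N\<close> positive, so that the bound on the
    average can be multiplied by \<open>N\<close>.\<close>
  have bound: "real m * ln (F (k + N + m)) \<le> K" if "N0 + 1 \<le> N" for N
  proof -
    have "(\<Sum>i<N. ln (F (k + (i + m))) - ln (F (k + i)))
        \<le> (\<Sum>i<N. 2 * (G (map s [i..<i + (k + m)]) - 1))"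
    proof (rule sum_mono)
      fix i
      let ?x = "sqrt (F (k + i + m)) / sqrt (F (k + i))"
      have "ln (F (k + (i + m))) - ln (F (k + i)) = 2 * ln ?x"
        using F_pos[of "k + i"] F_pos[of "k + (i + m)"] by (simp add: ln_div ln_sqrt add.assoc)
      also have "\<dots> \<le> 2 * (?x - 1)"
        using ln_le_minus_one[of ?x] F_pos by simp
      also have "\<dots> \<le> 2 * (G (map s [i..<i + (k + m)]) - 1)"
        by (intro mult_left_mono diff_right_mono ratio) simp
      finally show "ln (F (k + (i + m))) - ln (F (k + i)) \<le> 2 * (G (map s [i..<i + (k + m)]) - 1)" .
    qed
    also have "\<dots> = 2 * ((\<Sum>i<N. G (map s [i..<i + (k + m)])) - real N)"
      by (simp add: sum_subtractf flip: sum_distrib_left)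
    \<comment> \<open>Only the sign of the drift matters here: boundedness is the goal.\<close>
    also have "\<dots> \<le> 0" using N0[of N] that by (simp add: divide_simps)
    finally have "(\<Sum>i<m. ln (F (k + (N + i)))) \<le> (\<Sum>i<m. ln (F (k + i)))"
      by (simp only: sum_lag[of "\<lambda>i. ln (F (k + i))"])
    moreover have "(\<Sum>i<m. ln (F (k + N + m))) \<le> (\<Sum>i<m. ln (F (k + (N + i))) + real m * ln B)"
    proof (rule sum_mono)
      fix i assume "i \<in> {..<m}"
      then have "ln (F (k + N + m)) \<le> ln (F (k + (N + i))) + real (m - i) * ln B"
        using ln_step[of "k + (N + i)" "m - i"] by (simp add: add.assoc)
      also have "\<dots> \<le> ln (F (k + (N + i))) + real m * ln B"
        using B(1) by (intro add_left_mono mult_right_mono) auto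
      finally show "ln (F (k + N + m)) \<le> ln (F (k + (N + i))) + real m * ln B" .
    qed
    ultimately show ?thesis by (simp add: K_def sum.distrib)
  qed
  define T where "T = k + (N0 + 1) + m"
  have "F n \<le> exp (K / real m) + (\<Sum>i\<le>T. F i)" for n
  proof (cases "n \<le> T")
    case True
    then have "F n \<le> (\<Sum>i\<le>T. F i)"
      by (intro member_le_sum) (auto simp: F_pos less_imp_le)
    then show ?thesis using exp_gt_zero[of "K / real m"] by linarith
  next
    case False
    then have "ln (F n) \<le> K / real m"
      using bound[of "n - k - m"] \<open>0 < m\<close> by (simp add: T_def field_simps)
    then have "F n \<le> exp (K / real m)" using F_pos[of n] by (metis exp_le_cancel_iff exp_ln)
    then show ?thesis using F_pos by (intro add_increasing2 sum_nonneg) (auto simp: less_imp_le)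
  qed
  then show ?thesis unfolding F_def by blast
qed

end

section \<open>Betting against a deviation of frequencies\<close>

lemma limsup_eq_infinityI:
  fixes g :: "nat \<Rightarrow> real"
  assumes "\<And>C m. \<exists>N\<ge>m. C \<le> g N"
  shows "limsup (\<lambda>N. ereal (g N)) = \<infinity>"
proof (rule ccontr)
  assume "limsup (\<lambda>N. ereal (g N)) \<noteq> \<infinity>"
  then obtain C :: nat where "limsup (\<lambda>N. ereal (g N)) < ereal (real C)"
    using less_PInf_Ex_of_nat by auto
  then have "\<forall>\<^sub>F N in sequentially. g N < real C"
    using Limsup_lessD by fastforce
  then obtain m where "\<And>N. m \<le> N \<Longrightarrow> g N < real C"
    by (auto simp: eventually_sequentially)
  with assms[of m "real C"] show False by force
qed

section \<open>Automata that remember a suffix, and their bets\<close>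

context markov_seq_measure
begin

text \<open>By the Markov property the last \<open>l \<ge> k\<close> symbols decide which symbols
  may follow, and this makes \<open>L\<close> regular.\<close>

lemma snoc_in_L_last_symbols:
  assumes "\<sigma> \<in> L" "k \<le> l"
  shows "\<sigma> @ [a] \<in> L \<longleftrightarrow> last_symbols l \<sigma> @ [a] \<in> L"
proof (cases "l \<le> length \<sigma>")
  case True
  have w: "last_symbols l \<sigma> \<in> L" using p_last_symbols_pos[OF assms(1)] by (simp add: in_L)
  have "p (\<sigma> @ [a]) / p \<sigma> = p (last_symbols l \<sigma> @ [a]) / p (last_symbols l \<sigma>)"
    using assms w True by (intro cond_cong) (auto simp: last_symbols_last_symbols)
  then show ?thesis
    using assms(1) w notin_L[of "\<sigma> @ [a]"] notin_L[of "last_symbols l \<sigma> @ [a]"] by (auto simp: in_L)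
qed (simp add: last_symbols_def)

text \<open>\<open>None\<close> is the sink for words outside \<open>L\<close>. The memory
  \<open>l\<close> may exceed \<open>k\<close>, since bets are placed after words of any length at
  least \<open>k\<close>.\<close>

definition suffix_dfa :: "nat \<Rightarrow> ('a list option, 'a) dfa" where
  "suffix_dfa l = \<lparr>dfa_states = insert None (Some ` {v. length v \<le> l}), dfa_init = Some [],
    dfa_final = Some ` {v. length v \<le> l},
    dfa_trans = (\<lambda>q a. case q of None \<Rightarrow> None
      | Some v \<Rightarrow> if v @ [a] \<in> L then Some (last_symbols l (v @ [a])) else None)\<rparr>"

lemma is_dfa_suffix_dfa: "is_dfa (suffix_dfa l)"
  using finite_lists_length_le[of "UNIV :: 'a set" l]
  by (auto simp: is_dfa_def suffix_dfa_def split: option.splits)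

lemma suffix_dfa_run:
  assumes "k \<le> l"
  shows "dfa_run (suffix_dfa l) \<sigma> = (if \<sigma> \<in> L then Some (last_symbols l \<sigma>) else None)"
proof (induction \<sigma> rule: rev_induct)
  case Nil
  then show ?case by (simp add: dfa_run_def suffix_dfa_def in_L last_symbols_def)
next
  case (snoc a \<sigma>)
  have "dfa_run (suffix_dfa l) (\<sigma> @ [a]) = dfa_trans (suffix_dfa l) (dfa_run (suffix_dfa l) \<sigma>) a"
    by (simp add: dfa_run_def)
  then show ?case
    using snoc snoc_in_L_last_symbols[OF _ assms, of \<sigma> a] L_prefix[of \<sigma> "[a]"]
    by (auto simp: suffix_dfa_def last_symbols_snoc)
qed

lemma suffix_dfa_lang: "k \<le> l \<Longrightarrow> dfa_lang (suffix_dfa l) = L"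
  by (auto simp: dfa_lang_def suffix_dfa_run) (auto simp: suffix_dfa_def)

text \<open>After \<open>w\<close> the bracket has conditional mean 0, which makes the bet fair; the
  sign of \<open>t\<close> chooses between betting on \<open>a\<close> and against it.\<close>

definition bet :: "'a list \<Rightarrow> 'a \<Rightarrow> real \<Rightarrow> 'a list \<Rightarrow> 'a \<Rightarrow> real" where
  "bet w a t v x = 1 + (if v = w then t * (of_bool (x = a) - p (w @ [a]) / p w) else 0)"

definition capital :: "'a list \<Rightarrow> 'a \<Rightarrow> real \<Rightarrow> 'a list \<Rightarrow> real" where
  "capital w a t \<sigma> = (\<Prod>i<length \<sigma>. bet w a t (last_symbols (length w) (take i \<sigma>)) (\<sigma> ! i))"

lemma capital_snoc:
  "capital w a t (\<sigma> @ [x]) = bet w a t (last_symbols (length w) \<sigma>) x * capital w a t \<sigma>"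
  by (simp add: capital_def nth_append)

lemma cond_snoc_le_1: "p (w @ [a]) / p w \<le> 1"
proof -
  have "p w = 0 \<or> 0 < p w" using p_nonneg[of w] by linarith
  then show ?thesis using p_append_le[of w "[a]"] by (auto simp: divide_le_eq_1_pos)
qed

lemma bet_bound:
  assumes "\<bar>t\<bar> \<le> 1 / 2"
  shows "\<bar>bet w a t v x - 1\<bar> \<le> \<bar>t\<bar>"
proof -
  have "\<bar>of_bool (x = a) - p (w @ [a]) / p w\<bar> \<le> 1"
    using cond_snoc_le_1[of w a] by (auto simp: of_bool_def)
  then have "\<bar>t * (of_bool (x = a) - p (w @ [a]) / p w)\<bar> \<le> \<bar>t\<bar>"
    unfolding abs_mult by (intro mult_left_le) auto
  then show ?thesis by (simp add: bet_def)
qed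

lemma capital_pos: "\<bar>t\<bar> \<le> 1 / 2 \<Longrightarrow> 0 < capital w a t \<sigma>"
  unfolding capital_def using bet_bound[of t w a] by (intro prod_pos) (smt (verit) field_sum_of_halves)

lemma capital_martingale:
  assumes w: "w \<in> L" "k \<le> length w" and t: "\<bar>t\<bar> \<le> 1 / 2"
  shows "word_martingale (capital w a t) P L"
  unfolding word_martingale_def
proof (intro conjI ballI)
  fix \<sigma> assume \<sigma>: "\<sigma> \<in> L"
  show "0 \<le> capital w a t \<sigma>" using capital_pos[OF t] less_imp_le by blast
  let ?v = "last_symbols (length w) \<sigma>" and ?q = "p (w @ [a]) / p w"
  \<comment> \<open>Fairness of one step: as \<open>w\<close> has length at least \<open>k\<close>,
    \<open>a\<close> has conditional probability \<open>p (w @ [a]) / p w\<close> after every word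
    of \<open>L\<close> ending in \<open>w\<close>.\<close>
  have "(\<Sum>x\<in>UNIV. p (\<sigma> @ [x]) * bet w a t ?v x) = p \<sigma>"
  proof (cases "?v = w")
    case True
    then have "length w \<le> length \<sigma>" by (metis length_last_symbols min.cobounded2)
    then have "p (\<sigma> @ [a]) / p \<sigma> = ?q"
      using w \<sigma> last_symbols_last_symbols[OF w(2), of \<sigma>] True by (intro cond_cong) auto
    then have q: "p (\<sigma> @ [a]) = ?q * p \<sigma>" using \<sigma> by (simp add: in_L divide_eq_eq)
    have "(\<Sum>x\<in>UNIV. p (\<sigma> @ [x]) * bet w a t ?v x)
        = (\<Sum>x\<in>UNIV. p (\<sigma> @ [x])) + t * ((\<Sum>x\<in>UNIV. if x = a then p (\<sigma> @ [x]) else 0)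
          - ?q * (\<Sum>x\<in>UNIV. p (\<sigma> @ [x])))"
      unfolding sum_distrib_left sum_subtractf[symmetric] sum.distrib[symmetric]
      by (rule sum.cong) (auto simp: bet_def True algebra_simps)
    also have "\<dots> = p \<sigma>" using q by (simp flip: p_snoc)
    finally show ?thesis .
  next
    case False
    then show ?thesis by (simp add: bet_def flip: p_snoc)
  qed
  then have "capital w a t \<sigma> = (\<Sum>x\<in>UNIV. p (\<sigma> @ [x]) * bet w a t ?v x) / p \<sigma> * capital w a t \<sigma>"
    using \<sigma> by (simp add: in_L)
  also have "\<dots> = (\<Sum>x\<in>UNIV. word_cond_prob P [x] \<sigma> * capital w a t (\<sigma> @ [x]))"
    by (simp add: capital_snoc word_cond_prob_def sum_divide_distrib sum_distrib_right mult.assoc)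
  also have "\<dots> = (\<Sum>x | \<sigma> @ [x] \<in> L. word_cond_prob P [x] \<sigma> * capital w a t (\<sigma> @ [x]))"
    by (rule sum.mono_neutral_right) (auto simp: notin_L word_cond_prob_def)
  finally show "capital w a t \<sigma> = (\<Sum>x | \<sigma> @ [x] \<in> L. word_cond_prob P [x] \<sigma> * capital w a t (\<sigma> @ [x]))" .
qed

lemma capital_generated:
  assumes "k \<le> length w"
  shows "dfa_generated L (capital w a t)"
proof (rule dfa_generated_any_state_type)
  \<comment> \<open>\<open>the\<close> meets only \<open>Some\<close>: if
    \<open>\<sigma> @ [a]\<close> is in \<open>L\<close>, so is \<open>\<sigma>\<close>, and the run
    has not reached the sink.\<close>
  show "dfa_generates (suffix_dfa (length w)) (\<lambda>q. bet w a t (the q)) L (capital w a t)"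
    using assms L_prefix
    by (auto simp: dfa_generates_def is_dfa_suffix_dfa suffix_dfa_lang suffix_dfa_run capital_snoc)
qed

text \<open>Write each factor as \<open>1 + d\<close> and use
  \<open>ln (1 + d) \<ge> d - 2 * d\<^sup>2\<close>; the linear parts add up exactly to the
  deviation of the conditional frequency. No bet can occur before \<open>length w\<close> symbols
  have been read, hence the shift of the prefix length.\<close>

lemma capital_growth:
  assumes t: "\<bar>t\<bar> \<le> 1 / 2"
  shows "real N * (t * (word_freq s (w @ [a]) N - p (w @ [a]) / p w * word_freq s w N)) - real N * (2 * t\<^sup>2)
    \<le> ln (capital w a t (seq_prefix (length w + N) s))"
\<comment> \<open>The factor \<open>1 / real N\<close> in \<open>word_freq\<close> cancels only for
  positive \<open>N\<close>; for \<open>N = 0\<close> no bet has been placed and the capital is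
  1.\<close>
proof (cases "N = 0")
  case True
  have "bet w a t (last_symbols (length w) (take i (seq_prefix (length w) s))) x = 1" if "i < length w" for i x
    using that by (simp add: bet_def last_symbols_neq)
  with True show ?thesis by (simp add: capital_def)
next
  case False
  let ?l = "length w" and ?q = "p (w @ [a]) / p w"
  define d where "d n = bet w a t (last_symbols ?l (seq_prefix n s)) (s n) - 1" for n
  have cap: "capital w a t (seq_prefix n s) = (\<Prod>i<n. 1 + d i)" for n
    by (induction n) (simp_all add: capital_snoc seq_prefix_Suc d_def, simp add: capital_def)
  have d: "\<bar>d n\<bar> \<le> \<bar>t\<bar>" for n unfolding d_def by (rule bet_bound[OF t])
  have d_pos: "0 < 1 + d n" for n using d[of n] t by linarith
  have d_0: "d n = 0" if "n < ?l" for n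
    using that by (simp add: d_def bet_def last_symbols_neq)
  have d_lag: "d (?l + n) = t * (of_bool (map s [n..<n + length (w @ [a])] = w @ [a])
      - ?q * of_bool (map s [n..<n + ?l] = w))" for n
    using last_symbols_prefix[of ?l "?l + n" s] by (auto simp: d_def bet_def add.commute)
  have "ln (capital w a t (seq_prefix (?l + N) s)) = (\<Sum>n<?l + N. ln (1 + d n))"
    unfolding cap using d_pos by (intro ln_prod) (auto simp: less_imp_neq[symmetric])
  also have "\<dots> = (\<Sum>n<N. ln (1 + d (?l + n)))"
    by (induction N) (auto simp: d_0 ac_simps intro!: sum.neutral)
  also have "\<dots> \<ge> (\<Sum>n<N. d (?l + n) - 2 * t\<^sup>2)"
  proof (rule sum_mono)
    fix n
    have "\<bar>ln (1 + d (?l + n)) - d (?l + n)\<bar> \<le> 2 * (d (?l + n))\<^sup>2"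
      using d[of "?l + n"] t by (intro abs_ln_one_plus_x_minus_x_bound) linarith
    moreover have "(d (?l + n))\<^sup>2 \<le> t\<^sup>2" using d[of "?l + n"] by (rule abs_le_square_iff[THEN iffD1])
    ultimately show "d (?l + n) - 2 * t\<^sup>2 \<le> ln (1 + d (?l + n))" by linarith
  qed
  finally have "(\<Sum>n<N. d (?l + n)) - real N * (2 * t\<^sup>2) \<le> ln (capital w a t (seq_prefix (?l + N) s))"
    by (simp add: sum_subtractf)
  moreover have "(\<Sum>n<N. d (?l + n)) = real N * (t * (word_freq s (w @ [a]) N - ?q * word_freq s w N))"
  proof -
    define X Y :: real where "X = (\<Sum>n<N. of_bool (map s [n..<n + length (w @ [a])] = w @ [a]))"
      and "Y = (\<Sum>n<N. of_bool (map s [n..<n + ?l] = w))"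
    have "(\<Sum>n<N. d (?l + n)) = t * (X - ?q * Y)"
      unfolding d_lag X_def Y_def by (simp only: sum_distrib_left sum_subtractf right_diff_distrib)
    also have "\<dots> = real N * (t * (1 / real N * X - ?q * (1 / real N * Y)))"
      using False by (simp add: right_diff_distrib)
    finally show ?thesis unfolding word_freq_def X_def Y_def .
  qed
  ultimately show ?thesis by simp
qed

text \<open>The sign \<open>u\<close> turns a deviation in either direction into a gain, and the
  logarithm of the capital exceeds a fixed multiple of \<open>N\<close> for infinitely many
  \<open>N\<close>.\<close>

lemma deviation_succeeds:
  assumes w: "k \<le> length w" "w \<in> L" and c: "0 < c" and u: "\<bar>u\<bar> = 1"
    and dev: "\<And>m. \<exists>N\<ge>m. c \<le> u * (word_freq s (w @ [a]) N - p (w @ [a]) / p w * word_freq s w N)"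
  shows "\<exists>f. word_martingale f P L \<and> dfa_generated L f \<and> succeeds_on f s"
proof -
  \<comment> \<open>Per step the linear gain is at least \<open>e * c\<close> and the quadratic loss
    \<open>2 * e\<^sup>2\<close>; with \<open>e \<le> c / 4\<close> a rate of
    \<open>e * (c / 2)\<close> remains. The bound 1/2 is the limit on bets in
    \<open>capital_growth\<close>.\<close>
  define e where "e = min (1 / 2) (c / 4)"
  have e: "0 < e" "e \<le> 1 / 2" "e \<le> c / 4" using c by (auto simp: e_def)
  then have t: "\<bar>u * e\<bar> \<le> 1 / 2" using u by (simp add: abs_mult)
  have "\<exists>n\<ge>m. C \<le> capital w a (u * e) (seq_prefix n s)" for C m
  proof -
    obtain M :: nat where M: "\<bar>C\<bar> / (e * (c / 2)) < real M" using reals_Archimedean2 by blast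
    obtain N where N: "max m M \<le> N"
      "c \<le> u * (word_freq s (w @ [a]) N - p (w @ [a]) / p w * word_freq s w N)"
      using dev by blast
    have "\<bar>C\<bar> < real M * (e * (c / 2))" using M e c by (simp add: divide_less_eq)
    also have "\<dots> \<le> real N * (e * (c / 2))" using N e c by (intro mult_right_mono) auto
    also have "\<dots> \<le> real N * (e * (c - 2 * e))" using e by (intro mult_left_mono) auto
    also have "\<dots> \<le> real N * (e * (u * (word_freq s (w @ [a]) N - p (w @ [a]) / p w * word_freq s w N) - 2 * e))"
      using N(2) e(1) by (intro mult_left_mono diff_right_mono) auto
    also have "\<dots> = real N * (u * e * (word_freq s (w @ [a]) N - p (w @ [a]) / p w * word_freq s w N))
        - real N * (2 * (u * e)\<^sup>2)"
    proof -
      have "u\<^sup>2 = 1" using u by (metis power2_abs one_power2)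
      then have "(u * e)\<^sup>2 = e * e" by (simp add: power_mult_distrib power2_eq_square[of e])
      then show ?thesis by (simp only: right_diff_distrib mult_ac)
    qed
    also have "\<dots> \<le> ln (capital w a (u * e) (seq_prefix (length w + N) s))"
      by (rule capital_growth[OF t])
    also have "\<dots> \<le> capital w a (u * e) (seq_prefix (length w + N) s)"
      using capital_pos[OF t] by (rule ln_bound)
    finally show ?thesis using N(1) by (intro exI[of _ "length w + N"]) auto
  qed
  then have "succeeds_on (capital w a (u * e)) s"
    unfolding succeeds_on_def by (rule limsup_eq_infinityI)
  then show ?thesis
    using capital_martingale[OF w(2,1) t] capital_generated[OF w(1)] by blast
qed

lemma no_success_imp_conditional_freq:
  assumes no: "\<not> (\<exists>f. word_martingale f P L \<and> dfa_generated L f \<and> succeeds_on f s)"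
    and w: "k \<le> length w" "w \<in> L"
  shows "(\<lambda>N. word_freq s (w @ [a]) N - p (w @ [a]) / p w * word_freq s w N) \<longlonglongrightarrow> 0"
proof (rule LIMSEQ_I)
  let ?x = "\<lambda>N. word_freq s (w @ [a]) N - p (w @ [a]) / p w * word_freq s w N"
  fix c :: real assume c: "0 < c"
  have *: "\<not> (\<forall>m. \<exists>N\<ge>m. c \<le> u * ?x N)" if "\<bar>u\<bar> = 1" for u
    using deviation_succeeds[OF w c that, of s a] no by blast
  obtain m where m: "\<And>N. m \<le> N \<Longrightarrow> \<not> c \<le> 1 * ?x N"
    using *[of 1, OF abs_one] by blast
  obtain m' where m': "\<And>N. m' \<le> N \<Longrightarrow> \<not> c \<le> - 1 * ?x N"
    using *[of "- 1"] by fastforce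
  have "norm (?x N - 0) < c" if "max m m' \<le> N" for N
  proof -
    have "?x N < c" "- ?x N < c" using m[of N] m'[of N] that by (simp_all add: not_le)
    then show ?thesis unfolding real_norm_def by linarith
  qed
  then show "\<exists>m. \<forall>N\<ge>m. norm (?x N - 0) < c"
    by blast
qed

end

section \<open>Conditional frequencies determine frequencies\<close>

text \<open>Bolzano-Weierstrass once per index; passing to a further subsequence keeps the limits
  already obtained.\<close>

lemma convergent_subseq_finite:
  fixes x :: "'i \<Rightarrow> nat \<Rightarrow> real"
  assumes "finite W" and bound: "\<And>w n. \<bar>x w n\<bar> \<le> B"
  shows "\<exists>r :: nat \<Rightarrow> nat. strict_mono r \<and> (\<forall>w\<in>W. convergent (x w \<circ> r))"
  using \<open>finite W\<close>
proof (induction W rule: finite_induct)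
  case empty
  show ?case by (intro exI[of _ id]) (simp add: strict_mono_def)
next
  case (insert w W)
  then obtain r :: "nat \<Rightarrow> nat" where r: "strict_mono r" "\<forall>w\<in>W. convergent (x w \<circ> r)" by blast
  have "bounded (range (x w \<circ> r))"
    using bound by (intro boundedI[of _ B]) auto
  then obtain l r' where r': "strict_mono r'" "((x w \<circ> r) \<circ> r') \<longlonglongrightarrow> l"
    using bounded_imp_convergent_subsequence by blast
  have "convergent (x v \<circ> (r \<circ> r'))" if "v \<in> insert w W" for v
  proof (cases "v = w")
    case True
    then show ?thesis using r' by (auto simp: convergent_def comp_assoc)
  next
    case False
    then have "v \<in> W" using that by simp
    then obtain l' where "(x v \<circ> r) \<longlonglongrightarrow> l'" using r unfolding convergent_def by blast
    from LIMSEQ_subseq_LIMSEQ[OF this r'(1)] show ?thesis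
      by (auto simp: convergent_def comp_assoc)
  qed
  moreover have "strict_mono (r \<circ> r')" using r(1) r'(1) by (rule strict_mono_o)
  ultimately show ?case by blast
qed

lemma not_tendsto_subseq:
  fixes x :: "nat \<Rightarrow> real"
  assumes "\<not> x \<longlonglongrightarrow> l"
  obtains e r where "0 < e" "strict_mono (r :: nat \<Rightarrow> nat)" "\<And>n. e \<le> \<bar>x (r n) - l\<bar>"
proof -
  obtain e where e: "0 < e" "\<And>m. \<exists>n\<ge>m. e \<le> \<bar>x n - l\<bar>"
    using assms unfolding LIMSEQ_iff real_norm_def by (metis not_le)
  then have "infinite {n. e \<le> \<bar>x n - l\<bar>}"
    unfolding infinite_nat_iff_unbounded_le by blast
  from infinite_enumerate[OF this] e(1) show thesis using that by blast
qed

section \<open>Uniqueness of the stationary vector\<close>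

context markov_seq_measure
begin

text \<open>If \<open>p w = 0\<close>, the quotient is 0 by convention and
  \<open>p (w @ [a])\<close> is 0 as well.\<close>

lemma p_snoc_cond: "p (w @ [a]) / p w * p w = p (w @ [a])"
  using p_append_le[of w "[a]"] p_nonneg[of "w @ [a]"] by (cases "p w = 0") auto

context
  fixes \<mu> :: "'a list \<Rightarrow> real"
  assumes k: "1 \<le> k" and irr: "irreducible_measure P"
    and \<mu>_nonneg: "\<And>w. 0 \<le> \<mu> w" and \<mu>_L: "\<And>w. w \<notin> L \<Longrightarrow> \<mu> w = 0"
    and \<mu>_sum: "(\<Sum>w\<in>words k. \<mu> w) = 1"
    and stationary: "\<And>u a. length (u @ [a]) = k \<Longrightarrow>
      \<mu> (u @ [a]) = (\<Sum>b\<in>UNIV. p (b # u @ [a]) / p (b # u) * \<mu> (b # u))"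
begin

lemma p_stationary: "p (u @ [a]) = (\<Sum>b\<in>UNIV. p (b # u @ [a]) / p (b # u) * p (b # u))"
  using p_snoc_cond[of "_ # u" a] by (simp add: p_Cons[of "u @ [a]"])

text \<open>The difference of \<open>\<mu>\<close> and \<open>c * p\<close> is nonnegative and
  satisfies the same balance equations. Where it vanishes, it vanishes at every predecessor with
  positive transition probability; \<open>\<rho>\<close> is a path of such transitions, walked from
  its end to its start.\<close>

lemma zero_propagates_backwards:
  assumes ge: "\<And>w. length w = k \<Longrightarrow> c * p w \<le> \<mu> w"
  shows "k \<le> length \<rho> \<Longrightarrow> \<rho> \<in> L \<Longrightarrow>
    \<mu> (last_symbols k \<rho>) = c * p (last_symbols k \<rho>) \<Longrightarrow> \<mu> (take k \<rho>) = c * p (take k \<rho>)"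
proof (induction \<rho>)
  case (Cons b \<rho>)
  show ?case
  proof (cases "k = length (b # \<rho>)")
    case True
    then show ?thesis using Cons.prems by (simp add: last_symbols_def)
  next
    case False
    then have len: "k \<le> length \<rho>" using Cons.prems by simp
    then have "last_symbols k (b # \<rho>) = last_symbols k \<rho>"
      by (simp add: last_symbols_def Suc_diff_le)
    then have IH: "\<mu> (take k \<rho>) = c * p (take k \<rho>)"
      using Cons len L_suffix[of "[b]" \<rho>] by simp
    define u where "u = take (k - 1) \<rho>"
    define a where "a = \<rho> ! (k - 1)"
    have ua: "take k \<rho> = u @ [a]" "length u = k - 1"
      using len k take_Suc_conv_app_nth[of "k - 1" \<rho>] by (auto simp: u_def a_def)
    have bu: "take k (b # \<rho>) = b # u" using k by (cases k) (auto simp: u_def)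
    have "b # u @ [a] \<in> L"
      using Cons.prems(2) L_prefix[of "b # u @ [a]" "drop k \<rho>"] by (simp flip: ua(1))
    then have pos: "p (b # u @ [a]) \<noteq> 0" "p (b # u) \<noteq> 0"
      using L_prefix[of "b # u" "[a]"] by (auto simp: in_L)
    have "(\<Sum>b\<in>UNIV. p (b # u @ [a]) / p (b # u) * (\<mu> (b # u) - c * p (b # u)))
        = \<mu> (u @ [a]) - c * p (u @ [a])"
      using stationary[of u a] p_stationary[of u a] ua k
      by (simp add: right_diff_distrib sum_subtractf sum_distrib_left mult.left_commute)
    also have "\<dots> = 0" using IH ua by simp
    \<comment> \<open>A vanishing sum of nonnegative terms; the term of the actual predecessor has a
      positive coefficient because \<open>\<rho>\<close> lies in \<open>L\<close>.\<close>
    finally have "\<forall>b\<in>UNIV. p (b # u @ [a]) / p (b # u) * (\<mu> (b # u) - c * p (b # u)) = 0"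
      by (subst (asm) sum_nonneg_eq_0_iff) (use ge ua k in auto)
    then show ?thesis using pos by (simp only: bu) (auto dest: bspec[of _ _ b])
  qed
qed (use k in simp)

text \<open>Let \<open>c\<close> be the least ratio of \<open>\<mu>\<close> to \<open>p\<close> on
  the support. The nonnegative difference of \<open>\<mu>\<close> and \<open>c * p\<close> vanishes
  at the minimiser, which irreducibility makes reachable from every state, so it vanishes
  everywhere. Total mass then gives \<open>c = 1\<close>.\<close>

lemma stationary_unique:
  assumes w: "length w = k"
  shows "\<mu> w = p w"
proof -
  define K where "K = {w \<in> words k. w \<in> L}"
  have K_sum: "(\<Sum>w\<in>K. g w) = (\<Sum>w\<in>words k. g w)" if "\<And>w. w \<notin> L \<Longrightarrow> g w = 0" for g :: "'a list \<Rightarrow> real"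
    unfolding K_def by (rule sum.mono_neutral_left) (use that in auto)
  have p_sum: "(\<Sum>w\<in>words k. p w) = 1" using p_append[of "[]" k] by simp
  then have "K \<noteq> {}" using K_sum[of p] notin_L by auto
  moreover have "finite K" by (simp add: K_def)
  ultimately obtain w' where w': "w' \<in> K" "\<And>w. w \<in> K \<Longrightarrow> \<mu> w' / p w' \<le> \<mu> w / p w"
    using ex_is_arg_min_if_finite[of K "\<lambda>w. \<mu> w / p w"] unfolding is_arg_min_linorder by blast
  define c where "c = \<mu> w' / p w'"
  have ge: "c * p w \<le> \<mu> w" if "length w = k" for w
  proof (cases "w \<in> L")
    case True
    then show ?thesis using w'(2)[of w] that by (simp add: c_def K_def in_L le_divide_eq)
  qed (simp add: notin_L \<mu>_nonneg)
  have eq: "\<mu> w = c * p w" if "w \<in> K" for w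
  proof -
    have "0 < p w" "0 < p w'" using that w'(1) by (auto simp: K_def in_L)
    then obtain \<rho> where \<rho>: "0 < p (w @ \<rho> @ w')"
      using irr unfolding irreducible_measure_def by blast
    have "last_symbols k (w @ \<rho> @ w') = w'" "take k (w @ \<rho> @ w') = w"
      using that w'(1) by (auto simp: K_def last_symbols_def)
    then show ?thesis
      using zero_propagates_backwards[OF ge, of "w @ \<rho> @ w'"] \<rho> that \<open>0 < p w'\<close>
      by (simp add: in_L c_def K_def)
  qed
  have "1 = (\<Sum>w\<in>K. \<mu> w)" using K_sum[of \<mu>] \<mu>_L \<mu>_sum by simp
  also have "\<dots> = c * (\<Sum>w\<in>K. p w)" by (simp add: eq sum_distrib_left)
  also have "\<dots> = c" using K_sum[of p] p_sum notin_L by simp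
  finally show ?thesis
    using eq[of w] w by (cases "w \<in> L") (auto simp: K_def \<mu>_L notin_L)
qed

end

text \<open>Words of length \<open>k\<close> are settled by compactness and
  \<open>stationary_unique\<close>, longer words by multiplying with conditional probabilities,
  shorter ones as marginals.\<close>

lemma conditional_freq_imp_freq:
  assumes k: "1 \<le> k" and irr: "irreducible_measure P"
    and s: "\<And>N. seq_prefix N s \<in> L"
    and cond: "\<And>w a. k \<le> length w \<Longrightarrow> w \<in> L \<Longrightarrow>
      (\<lambda>N. word_freq s (w @ [a]) N - p (w @ [a]) / p w * word_freq s w N) \<longlonglongrightarrow> 0"
  shows "word_freq s \<sigma> \<longlonglongrightarrow> p \<sigma>"
proof -
  \<comment> \<open>For \<open>w\<close> outside \<open>L\<close> both frequencies are 0. The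
    balance equations sum over all preceding symbols, including impossible ones.\<close>
  have cond': "(\<lambda>N. word_freq s (w @ [a]) N - p (w @ [a]) / p w * word_freq s w N) \<longlonglongrightarrow> 0"
    if "k \<le> length w" for w a
  proof (cases "w \<in> L")
    case False
    then have "w @ [a] \<notin> L" using L_prefix by blast
    then show ?thesis using False s by (simp add: word_freq_notin_L notin_L)
  qed (rule cond[OF that])
  have base: "word_freq s w \<longlonglongrightarrow> p w" if w: "length w = k" for w
  proof (rule ccontr)
    assume "\<not> word_freq s w \<longlonglongrightarrow> p w"
    then obtain e and r :: "nat \<Rightarrow> nat" where e: "0 < e" and r: "strict_mono r" "\<And>n. e \<le> \<bar>word_freq s w (r n) - p w\<bar>"
      using not_tendsto_subseq by blast
    obtain r' where r': "strict_mono r'" "\<forall>v\<in>words k. convergent ((\<lambda>n. word_freq s v (r n)) \<circ> r')"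
      using convergent_subseq_finite[of "words k" "\<lambda>v n. word_freq s v (r n)" 1]
        word_freq_nonneg[of s] word_freq_le_1[of s] by (auto simp: abs_le_iff)
    define q where "q n = r (r' n)" for n
    define \<mu> where "\<mu> v = (if length v = k then lim (\<lambda>n. word_freq s v (q n)) else 0)" for v
    have q: "strict_mono q" using strict_mono_o[OF r(1) r'(1)] by (simp add: q_def[abs_def] comp_def)
    have \<mu>: "(\<lambda>n. word_freq s v (q n)) \<longlonglongrightarrow> \<mu> v" if "length v = k" for v
      using r'(2) that by (simp add: \<mu>_def q_def comp_def convergent_LIMSEQ_iff)
    have "\<mu> w = p w"
    proof (rule stationary_unique[OF k irr])
      show "0 \<le> \<mu> v" for v
      proof (cases "length v = k")
        case True
        from \<mu>[OF this] show ?thesis by (rule LIMSEQ_le_const) (simp add: word_freq_nonneg)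
      qed (simp add: \<mu>_def)
      show "\<mu> v = 0" if "v \<notin> L" for v
        using that s by (simp add: \<mu>_def word_freq_notin_L)
      show "(\<Sum>v\<in>words k. \<mu> v) = 1"
      proof (rule LIMSEQ_unique)
        show "(\<lambda>n. \<Sum>v\<in>words k. word_freq s v (q n)) \<longlonglongrightarrow> (\<Sum>v\<in>words k. \<mu> v)"
          by (intro tendsto_sum \<mu>) simp
        have "(\<Sum>v\<in>words k. word_freq s v N) = 1" if "0 < N" for N
          using word_freq_append[of s "[]" N k] that by (simp add: word_freq_def)
        moreover have "0 < q n" if "0 < n" for n using seq_suble[OF q, of n] that by linarith
        ultimately show "(\<lambda>n. \<Sum>v\<in>words k. word_freq s v (q n)) \<longlonglongrightarrow> 1"
          by (intro tendsto_eventually eventually_mono[OF eventually_gt_at_top[of 0]]) auto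
      qed
      show "\<mu> (u @ [a]) = (\<Sum>b\<in>UNIV. p (b # u @ [a]) / p (b # u) * \<mu> (b # u))"
        if len: "length (u @ [a]) = k" for u a
      proof (rule LIMSEQ_unique[OF \<mu>[OF len]])
        have 1: "(\<lambda>n. word_freq s (u @ [a]) (q n) - (\<Sum>b\<in>UNIV. word_freq s (b # u @ [a]) (q n))) \<longlonglongrightarrow> 0"
          using LIMSEQ_subseq_LIMSEQ[OF word_freq_Cons_tendsto[of s "u @ [a]"] q] by (simp add: comp_def)
        have 2: "(\<lambda>n. word_freq s (b # u @ [a]) (q n) - p (b # u @ [a]) / p (b # u) * word_freq s (b # u) (q n)) \<longlonglongrightarrow> 0"
          for b
          using LIMSEQ_subseq_LIMSEQ[OF cond'[of "b # u" a] q] len by (simp add: comp_def)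
        have 3: "(\<lambda>n. word_freq s (b # u) (q n)) \<longlonglongrightarrow> \<mu> (b # u)" for b
          by (rule \<mu>) (use len in simp)
        \<comment> \<open>Splitting by the preceding symbol is exact up to a vanishing boundary
          term, and each summand is a conditional probability times a frequency up to a vanishing
          error.\<close>
        have "(\<lambda>n. (word_freq s (u @ [a]) (q n) - (\<Sum>b\<in>UNIV. word_freq s (b # u @ [a]) (q n)))
            + (\<Sum>b\<in>UNIV. (word_freq s (b # u @ [a]) (q n) - p (b # u @ [a]) / p (b # u) * word_freq s (b # u) (q n))
                + p (b # u @ [a]) / p (b # u) * word_freq s (b # u) (q n)))
          \<longlonglongrightarrow> 0 + (\<Sum>b\<in>UNIV. 0 + p (b # u @ [a]) / p (b # u) * \<mu> (b # u))"
          by (intro tendsto_add tendsto_sum tendsto_mult tendsto_const 1 2 3)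
        then show "(\<lambda>n. word_freq s (u @ [a]) (q n)) \<longlonglongrightarrow> (\<Sum>b\<in>UNIV. p (b # u @ [a]) / p (b # u) * \<mu> (b # u))"
          by simp
      qed
    qed (rule w)
    then have "(\<lambda>n. word_freq s w (q n)) \<longlonglongrightarrow> p w" using \<mu>[OF w] by simp
    from LIMSEQ_D[OF this e] obtain n where "\<bar>word_freq s w (q n) - p w\<bar> < e"
      by (metis order_refl real_norm_def)
    with r(2)[of "r' n"] show False by (simp add: q_def)
  qed
  have long: "word_freq s (w @ \<tau>) \<longlonglongrightarrow> p (w @ \<tau>)" if "length w = k" for w \<tau>
  proof (induction \<tau> rule: rev_induct)
    case (snoc a \<tau>)
    have "(\<lambda>N. (word_freq s ((w @ \<tau>) @ [a]) N - p ((w @ \<tau>) @ [a]) / p (w @ \<tau>) * word_freq s (w @ \<tau>) N)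
        + p ((w @ \<tau>) @ [a]) / p (w @ \<tau>) * word_freq s (w @ \<tau>) N)
      \<longlonglongrightarrow> 0 + p ((w @ \<tau>) @ [a]) / p (w @ \<tau>) * p (w @ \<tau>)"
      using that by (intro tendsto_add tendsto_mult tendsto_const snoc cond') simp
    then show ?case by (simp add: p_snoc_cond[of "w @ \<tau>" a, simplified])
  qed (use base that in simp)
  \<comment> \<open>Appending \<open>k\<close> symbols makes any \<open>\<sigma>\<close> long enough
    for \<open>long\<close>.\<close>
  have "(\<lambda>N. \<Sum>\<tau>\<in>words k. word_freq s (\<sigma> @ \<tau>) N) \<longlonglongrightarrow> (\<Sum>\<tau>\<in>words k. p (\<sigma> @ \<tau>))"
  proof (rule tendsto_sum)
    fix \<tau> :: "'a list" assume "\<tau> \<in> words k"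
    then have "length (take k (\<sigma> @ \<tau>)) = k" by simp
    from long[OF this, of "drop k (\<sigma> @ \<tau>)"] show "word_freq s (\<sigma> @ \<tau>) \<longlonglongrightarrow> p (\<sigma> @ \<tau>)"
      by (simp only: append_take_drop_id)
  qed
  then show ?thesis by (simp flip: word_freq_append p_append)
qed

end

theorem theorem1p3:
  fixes P :: "(nat \<Rightarrow> 'a::finite) measure" and k :: nat and s :: "nat \<Rightarrow> 'a"
  assumes "k \<ge> 1"
    and "seq_prob_measure P"
    and "irreducible_measure P"
    and "shift_invariant P"
    and "step_markov k P"
    and "\<forall>N. seq_prefix N s \<in> support_lang P"
  shows "distributed_seq P s \<longleftrightarrow>
    \<not> (\<exists>f. word_martingale f P (support_lang P) \<and>
           dfa_generated (support_lang P) f \<and> succeeds_on f s)"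
proof -
  interpret markov_seq_measure P k
    using assms by unfold_locales auto
  have s: "seq_prefix N s \<in> L" for N using assms(6) by blast
  show ?thesis
  proof
    assume dist: "distributed_seq P s"
    show "\<not> (\<exists>f. word_martingale f P L \<and> dfa_generated L f \<and> succeeds_on f s)"
    proof
      assume "\<exists>f. word_martingale f P L \<and> dfa_generated L f \<and> succeeds_on f s"
      then obtain f A b where f: "word_martingale f P L" "dfa_generates (A :: (nat, 'a) dfa) b L f"
          "succeeds_on f s"
        unfolding dfa_generated_def by blast
      then interpret dfa_martingale P k f A b by unfold_locales
      obtain M where "\<And>N. f (seq_prefix N s) \<le> M"
        using distributed_imp_bounded[OF dist s] by blast
      then have "limsup (\<lambda>N. ereal (f (seq_prefix N s))) \<le> ereal M"
        by (intro Limsup_bounded always_eventually) auto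
      then show False using f(3) by (simp add: succeeds_on_def)
    qed
  next
    assume "\<not> (\<exists>f. word_martingale f P L \<and> dfa_generated L f \<and> succeeds_on f s)"
    then have "word_freq s \<sigma> \<longlonglongrightarrow> p \<sigma>" for \<sigma>
      using no_success_imp_conditional_freq
      by (intro conditional_freq_imp_freq assms(1,3) s) auto
    then show "distributed_seq P s" by (rule distributedI)
  qed
qed

end
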